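(* For $1<q<\infty$, $q\neq 2$, let $F_q:\mathscr{S}(\mathbb{R})\setminus\{0\}\to\mathbb{R}_{>0}$ be defined by $$F_q(f)=\frac{\|f\|_q\,\|\hat f\|_q}{\|f\|_2\,\|\hat f\|_2}.$$ If $2<q<\infty$, then the image of $F_q$ is all of $\mathbb{R}_{>0}$. If $1<q<2$, then the image of $F_q$ is bounded below by $1$, i.e. $F_q(f)\geq 1$ for every $f\in\mathscr{S}(\mathbb{R})\setminus\{0\}$.
   Context: $\mathscr{S}(\mathbb{R})$ is the Schwartz space of (complex-valued) functions on the real line. The Fourier transform is $\hat f(\xi)=\int_{\mathbb{R}} f(x)e^{-2\pi i x\xi}\,dx$ for $f\in\mathscr{S}(\mathbb{R})$. For $1\le q<\infty$, $\|f\|_q=\big(\int_{\mathbb{R}}|f(x)|^q\,dx\big)^{1/q}$ is the $L^q$ norm. $\mathbb{R}_{>0}=(0,\infty)$. *)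

theory Defs
  imports "HOL-Analysis.Analysis"
begin

definition iter_deriv :: "nat \<Rightarrow> (real \<Rightarrow> complex) \<Rightarrow> real \<Rightarrow> complex" where
  "iter_deriv n = (\<lambda>g x. vector_derivative g (at x)) ^^ n"

text \<open>The value of \<open>vector_derivative\<close> is unspecified at points of non-differentiability, so the
  first conjunct, applied to all orders, is what makes \<open>f\<close> smooth and \<open>iter_deriv\<close> meaningful.\<close>

definition schwartz :: "(real \<Rightarrow> complex) set" where
  "schwartz = {f.
     (\<forall>n x. iter_deriv n f differentiable at x) \<and>
     (\<forall>m n. bounded (range (\<lambda>x. of_real (x ^ m) * iter_deriv n f x)))}"

definition fourier :: "(real \<Rightarrow> complex) \<Rightarrow> real \<Rightarrow> complex" where
  "fourier f \<xi> = (LINT x|lborel. f x * exp (- 2 * of_real pi * \<i> * of_real x * of_real \<xi>))"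

definition Lq_norm :: "real \<Rightarrow> (real \<Rightarrow> complex) \<Rightarrow> real" where
  "Lq_norm q f = (LINT x|lborel. norm (f x) powr q) powr (1 / q)"

definition Fq :: "real \<Rightarrow> (real \<Rightarrow> complex) \<Rightarrow> real" where
  "Fq q f = (Lq_norm q f * Lq_norm q (fourier f)) / (Lq_norm 2 f * Lq_norm 2 (fourier f))"

end

theory Submission
  imports Defs "HOL-Probability.Probability" "HOL-Complex_Analysis.Complex_Analysis"
    "HOL-Real_Asymp.Real_Asymp"
begin

text \<open>For \<open>q < 2\<close>, interpolating the bilinear form \<open>\<integral> fourier u * v\<close> between its trivial \<open>L\<^sup>1\<close> bound and
  its \<open>L\<^sup>2\<close> bound (Bessel) with the three lines theorem gives the bound by the product of the \<open>L\<^sup>q\<close>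
  norms; with \<open>v\<close> the conjugate of the transform of \<open>u = f\<close>, the form is the squared \<open>L\<^sup>2\<close> norm of \<open>f\<close>
  by Plancherel.

  For \<open>q > 2\<close>, the chirps \<open>exp (- \<pi> (1 + i s) x\<^sup>2)\<close> give all values in \<open>(0, c]\<close>, where
  \<open>c = sqrt 2 * q powr (- 1 / q)\<close> is the value of a Gaussian. The sum of a Gaussian of width \<open>sqrt b\<close> and
  one of width \<open>1 / sqrt b\<close>, normalised in \<open>L\<^sup>2\<close>, is its own transform; along this family \<open>Fq\<close> starts
  at \<open>c\<close> for \<open>b = 1\<close>, is continuous and tends to infinity, so the intermediate value theorem gives
  all values in \<open>[c, \<infinity>)\<close>.\<close>

text \<open>The case q < 2 is classically Hoelder followed by Hausdorff-Young, with the conjugate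
  exponent in between. Interpolating the bilinear form keeps the same exponent on both factors: 1/q
  lies between the endpoint values 1 and 1/2, and no dual norm occurs. At the endpoint 1/2 the
  arguments are simple functions, whose transforms are not known beforehand to be square integrable;
  so the L2 statements are first proved under a Gaussian weight, which is then removed by dominated
  convergence.

  For q > 2 a dilated Gaussian gives nothing new, since dilation leaves the quotient unchanged. A
  chirp keeps the modulus of the function and spreads its transform, and at fixed L2 norm spreading
  lowers the L^q norm; chirps therefore only lead down from c. To go up, the function and its
  transform must both have a tall peak, which a single Gaussian cannot achieve. In the sum of a wide
  and a narrow one, each term is the transform of the other, so the peak is present on both sides
  while the L2 norm stays bounded.\<close>

section \<open>Hadamard's three lines theorem on the closed unit strip\<close>

text \<open>\<open>E\<close> divides out the expected bound, so that the product with
  \<open>F\<close> has modulus at most 1 on both edges; a Gaussian factor forces decay along the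
  strip, the maximum modulus principle applies on a rectangle, and the factor is removed by
  \<open>e \<rightarrow> 0\<close>.\<close>

lemma three_lines:
  fixes F :: "complex \<Rightarrow> complex"
  assumes hol: "F holomorphic_on {z. 0 < Re z \<and> Re z < 1}"
    and cont: "continuous_on {z. 0 \<le> Re z \<and> Re z \<le> 1} F"
    and B: "\<And>z. 0 \<le> Re z \<Longrightarrow> Re z \<le> 1 \<Longrightarrow> norm (F z) \<le> B"
    and M0: "\<And>z. Re z = 0 \<Longrightarrow> norm (F z) \<le> M0"
    and M1: "\<And>z. Re z = 1 \<Longrightarrow> norm (F z) \<le> M1"
    and pos: "0 < M0" "0 < M1"
    and z: "0 \<le> Re z" "Re z \<le> 1"
  shows "norm (F z) \<le> M0 powr (1 - Re z) * M1 powr Re z"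
proof -
  define E where "E w = exp (- (1 - w) * of_real (ln M0) - w * of_real (ln M1))" for w :: complex
  \<comment> \<open>Subtracting 1 from the square compensates \<open>(Re w)\<^sup>2 \<le> 1\<close>,
    so on the strip the factor is bounded by a pure Gaussian in \<open>Im w\<close> and never
    exceeds 1.\<close>
  define G where "G e w = F w * E w * exp (of_real e * (w\<^sup>2 - 1))" for e :: real and w :: complex
  define K where "K = exp (\<bar>ln M0\<bar> + \<bar>ln M1\<bar>)"
  have normE: "norm (E w) = exp (- (1 - Re w) * ln M0 - Re w * ln M1)" for w
    by (simp add: E_def)
  have E_le: "norm (E w) \<le> K" if "0 \<le> Re w" "Re w \<le> 1" for w
  proof -
    have le_abs: "- c * l \<le> \<bar>l\<bar>" if "0 \<le> c" "c \<le> 1" for c l :: real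
    proof -
      have "- c * l \<le> c * \<bar>l\<bar>" using that(1) mult_left_mono[of "- l" "\<bar>l\<bar>" c] by simp
      also have "\<dots> \<le> \<bar>l\<bar>" using that by (simp add: mult_left_le_one_le)
      finally show ?thesis .
    qed
    show ?thesis
      using le_abs[of "1 - Re w" "ln M0"] le_abs[of "Re w" "ln M1"] that by (simp add: normE K_def)
  qed
  have B0: "0 \<le> B" using order_trans[OF norm_ge_zero B[of 0]] by simp
  have K0: "0 < K" by (simp add: K_def)
  have decay: "norm (exp (of_real e * (w\<^sup>2 - 1))) \<le> exp (- e * (Im w)\<^sup>2)"
    if "0 \<le> Re w" "Re w \<le> 1" "0 < e" for w and e :: real
  proof -
    have "(Re w)\<^sup>2 \<le> 1" using that by (simp add: power_le_one)
    then have "e * ((Re w)\<^sup>2 - (Im w)\<^sup>2 - 1) \<le> e * (- (Im w)\<^sup>2)"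
      using that by (intro mult_left_mono) auto
    then show ?thesis by (simp add: power2_eq_square)
  qed
  have edge: "norm (F w) * norm (E w) \<le> 1" if w: "Re w = 0 \<or> Re w = 1" for w
  proof -
    have "norm (F w) * norm (E w) \<le> (if Re w = 0 then M0 else M1) * norm (E w)"
      using w M0[of w] M1[of w] by (intro mult_right_mono) auto
    also have "\<dots> = 1" using w pos by (auto simp: normE exp_minus)
    finally show ?thesis .
  qed
  have *: "norm (G e z) \<le> 1" if e: "0 < e" for e
  proof -
    \<comment> \<open>The global bound \<open>B\<close> matters only on the horizontal sides of the
      rectangle, where the Gaussian beats \<open>B * K\<close> once \<open>R\<close> is large;
      \<open>R\<close> must also be large enough to enclose \<open>z\<close>.\<close>
    have "((\<lambda>R. exp (- e * R\<^sup>2)) \<longlongrightarrow> 0) at_top"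
      using e by real_asymp
    from tendsto_mult_left[OF this, of "B * K"]
    have "eventually (\<lambda>R. B * K * exp (- e * R\<^sup>2) < 1) at_top"
      by (intro order_tendstoD) auto
    then have "eventually (\<lambda>R. B * K * exp (- e * R\<^sup>2) < 1 \<and> \<bar>Im z\<bar> \<le> R \<and> 0 < R) at_top"
      by (intro eventually_conj eventually_ge_at_top eventually_gt_at_top)
    then obtain R where R: "B * K * exp (- e * R\<^sup>2) < 1" "\<bar>Im z\<bar> \<le> R" "0 < R"
      by (auto dest: eventually_happens)
    define S where "S = cbox (Complex 0 (-R)) (Complex 1 R)"
    have S_iff: "w \<in> S \<longleftrightarrow> 0 \<le> Re w \<and> Re w \<le> 1 \<and> \<bar>Im w\<bar> \<le> R" for w
      by (auto simp: S_def in_cbox_complex_iff)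
    have intS: "interior S = box (Complex 0 (-R)) (Complex 1 R)"
      by (simp add: S_def)
    have "norm (G e z) \<le> 1"
    proof (rule maximum_modulus_frontier[of "G e" S])
      show "G e holomorphic_on interior S"
        unfolding G_def[abs_def] E_def intS
        by (intro holomorphic_intros holomorphic_on_subset[OF hol]) (auto simp: in_box_complex_iff)
      show "continuous_on (closure S) (G e)"
        unfolding G_def[abs_def] E_def
        by (intro continuous_intros continuous_on_subset[OF cont]) (auto simp: S_def in_cbox_complex_iff)
      show "bounded S" by (simp add: S_def)
      show "z \<in> S" using z R by (simp add: S_iff)
      fix w assume w: "w \<in> frontier S"
      then have w1: "w \<in> S" "w \<notin> interior S"
        by (auto simp: frontier_def S_def)
      then have "Re w = 0 \<or> Re w = 1 \<or> \<bar>Im w\<bar> = R"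
        unfolding intS S_iff in_box_complex_iff by auto
      moreover have G_le: "norm (G e w) \<le> norm (F w) * norm (E w) * exp (- e * (Im w)\<^sup>2)"
        using w1 e decay[of w e] by (auto simp: G_def norm_mult S_iff intro!: mult_left_mono)
      moreover have "norm (F w) * norm (E w) * exp (- e * (Im w)\<^sup>2) \<le> 1" if "Re w = 0 \<or> Re w = 1"
        using mult_mono[OF edge[OF that], of "exp (- e * (Im w)\<^sup>2)" 1] e by simp
      moreover have "norm (F w) * norm (E w) * exp (- e * (Im w)\<^sup>2) \<le> 1" if "\<bar>Im w\<bar> = R"
      proof -
        have "norm (F w) * norm (E w) * exp (- e * (Im w)\<^sup>2) \<le> B * K * exp (- e * (Im w)\<^sup>2)"
          using w1 B0 K0 by (intro mult_mono B E_le) (auto simp: S_iff)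
        moreover have "(Im w)\<^sup>2 = R\<^sup>2" using that by (metis power2_abs)
        ultimately show ?thesis using R(1) by (metis order_trans less_imp_le)
      qed
      ultimately show "norm (G e w) \<le> 1" by fastforce
    qed
    then show ?thesis .
  qed
  have "((\<lambda>e. norm (G e z)) \<longlongrightarrow> norm (G 0 z)) (at_right 0)"
    unfolding G_def by (intro tendsto_intros)
  then have "norm (G 0 z) \<le> 1"
    by (rule tendsto_upperbound) (auto simp: eventually_at_right_less * intro: eventually_mono[OF eventually_at_right_less])
  then have "norm (F z) * norm (E z) \<le> 1" by (simp add: G_def norm_mult)
  moreover have "norm (E z) = inverse (M0 powr (1 - Re z) * M1 powr Re z)"
    using pos by (simp add: normE powr_def exp_minus [symmetric] exp_add [symmetric] algebra_simps)
  ultimately show ?thesis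
    using pos by (simp add: field_simps)
qed

section \<open>Integrability of products and the Cauchy-Schwarz inequality\<close>

lemma integrable_mult_bounded:
  fixes f g :: "'a \<Rightarrow> complex"
  assumes "integrable M f" and [measurable]: "g \<in> borel_measurable M"
    and "\<And>x. norm (g x) \<le> C"
  shows "integrable M (\<lambda>x. f x * g x)"
proof (rule Bochner_Integration.integrable_bound)
  show "integrable M (\<lambda>x. C * norm (f x))" using assms by simp
  show "(\<lambda>x. f x * g x) \<in> borel_measurable M"
    using assms(1) by (auto dest: borel_measurable_integrable)
  have "norm (f x * g x) \<le> norm (C * norm (f x))" for x
  proof -
    have "0 \<le> C" using order_trans[OF norm_ge_zero assms(3)] .
    then show ?thesis
      using mult_left_mono[OF assms(3)[of x], of "norm (f x)"] by (simp add: norm_mult abs_mult mult.commute)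
  qed
  then show "AE x in M. norm (f x * g x) \<le> norm (C * norm (f x))" by simp
qed

lemma integrable_pair_mult:
  fixes f g :: "real \<Rightarrow> complex"
  assumes "integrable lborel f" "integrable lborel g"
  shows "integrable (lborel \<Otimes>\<^sub>M lborel) (\<lambda>(x, y). f x * g y)"
proof (rule lborel_pair.Fubini_integrable)
  have [measurable]: "f \<in> borel_measurable borel" "g \<in> borel_measurable borel"
    using assms[THEN borel_measurable_integrable] by simp_all
  show "(\<lambda>(x, y). f x * g y) \<in> borel_measurable (lborel \<Otimes>\<^sub>M lborel)" by measurable
  show "integrable lborel (\<lambda>x. LINT y|lborel. norm (case (x, y) of (x, y) \<Rightarrow> f x * g y))"
    using assms by (simp add: norm_mult)
  show "AE x in lborel. integrable lborel (\<lambda>y. case (x, y) of (x, y) \<Rightarrow> f x * g y)"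
    using assms by simp
qed

lemma integrable_pair_mult_bounded:
  fixes f g :: "real \<Rightarrow> complex" and k :: "real \<Rightarrow> real \<Rightarrow> complex"
  assumes "integrable lborel f" "integrable lborel g"
    and "case_prod k \<in> borel_measurable (lborel \<Otimes>\<^sub>M lborel)"
    and "\<And>x y. norm (k x y) \<le> C"
  shows "integrable (lborel \<Otimes>\<^sub>M lborel) (\<lambda>(x, y). f x * g y * k x y)"
  using integrable_mult_bounded[OF integrable_pair_mult[OF assms(1,2)] assms(3), of C] assms(4)
  by (simp add: case_prod_beta')

lemma Cauchy_Schwarz_integral:
  fixes f g :: "'a \<Rightarrow> complex"
  assumes [measurable]: "f \<in> borel_measurable M" "g \<in> borel_measurable M"
    and "integrable M (\<lambda>x. (norm (f x))\<^sup>2)" "integrable M (\<lambda>x. (norm (g x))\<^sup>2)"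
  shows "norm (LINT x|M. f x * g x)
    \<le> sqrt (LINT x|M. (norm (f x))\<^sup>2) * sqrt (LINT x|M. (norm (g x))\<^sup>2)"
proof -
  define N where "N = (\<integral>\<^sup>+x. ennreal (norm (f x)) * ennreal (norm (g x)) \<partial>M)"
  have "ennreal ((norm (LINT x|M. f x * g x))\<^sup>2) = (ennreal (norm (LINT x|M. f x * g x)))\<^sup>2"
    by (simp add: ennreal_power)
  also have "\<dots> \<le> N\<^sup>2"
    using integral_norm_bound_ennreal[of M "\<lambda>x. f x * g x"]
    \<comment> \<open>In the non-integrable case the Bochner integral is 0 by convention and the
      estimate is trivial.\<close>
    by (cases "integrable M (\<lambda>x. f x * g x)")
      (auto simp: N_def norm_mult ennreal_mult not_integrable_integral_eq intro!: power_mono)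
  also have "\<dots> \<le> (\<integral>\<^sup>+x. (ennreal (norm (f x)))\<^sup>2 \<partial>M) * (\<integral>\<^sup>+x. (ennreal (norm (g x)))\<^sup>2 \<partial>M)"
    unfolding N_def by (rule Cauchy_Schwarz_nn_integral) auto
  also have "\<dots> = ennreal ((LINT x|M. (norm (f x))\<^sup>2) * (LINT x|M. (norm (g x))\<^sup>2))"
    using assms by (simp add: ennreal_power nn_integral_eq_integral ennreal_mult)
  finally have "(norm (LINT x|M. f x * g x))\<^sup>2 \<le> (LINT x|M. (norm (f x))\<^sup>2) * (LINT x|M. (norm (g x))\<^sup>2)"
    by (subst (asm) ennreal_le_iff) auto
  then show ?thesis
    by (simp add: real_le_rsqrt real_sqrt_mult [symmetric])
qed

section \<open>The Fourier integral of integrable functions and of Gaussians\<close>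

lemma fourier_cis: "fourier f \<xi> = (LINT x|lborel. f x * cis (- 2 * pi * x * \<xi>))"
  unfolding fourier_def cis_conv_exp by (simp add: mult.assoc mult.left_commute)

lemma borel_measurable_cis [measurable]: "cis \<in> borel_measurable borel"
  by (intro borel_measurable_continuous_onI continuous_intros)

lemma borel_measurable_cnj [measurable]: "cnj \<in> borel_measurable borel"
  by (intro borel_measurable_continuous_onI continuous_intros)

lemma integrable_mult_cis:
  assumes "integrable lborel f" and [measurable]: "g \<in> borel_measurable lborel"
  shows "integrable lborel (\<lambda>x. f x * cis (g x))"
  by (rule integrable_mult_bounded[OF assms(1), where C = 1]) auto

lemma norm_fourier_le: "norm (fourier f \<xi>) \<le> (LINT x|lborel. norm (f x))"
  unfolding fourier_cis by (rule order_trans[OF integral_norm_bound]) (simp add: norm_mult)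

lemma borel_measurable_fourier:
  assumes [measurable]: "f \<in> borel_measurable borel"
  shows "fourier f \<in> borel_measurable borel"
proof -
  have "(\<lambda>\<xi>. LINT x|lborel. f x * cis (- 2 * pi * x * \<xi>)) \<in> borel_measurable borel"
    by measurable
  then show ?thesis by (simp add: fourier_cis[abs_def])
qed

text \<open>Fubini: the kernel is symmetric in its two variables and has modulus 1, so integrability
  of both functions suffices. Both Bessel and Plancherel are drawn from this formula.\<close>

lemma fourier_multiplication:
  assumes u: "integrable lborel u" and v: "integrable lborel v"
  shows "(LINT \<xi>|lborel. fourier u \<xi> * v \<xi>) = (LINT x|lborel. u x * fourier v x)"
proof -
  have "integrable (lborel \<Otimes>\<^sub>M lborel) (\<lambda>(x, \<xi>). u x * v \<xi> * cis (- 2 * pi * x * \<xi>))"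
    by (rule integrable_pair_mult_bounded[OF u v, where C = 1]) auto
  from lborel_pair.Fubini_integral[OF this]
  have "(LINT \<xi>|lborel. LINT x|lborel. u x * v \<xi> * cis (- 2 * pi * x * \<xi>))
      = (LINT x|lborel. LINT \<xi>|lborel. u x * v \<xi> * cis (- 2 * pi * x * \<xi>))" .
  moreover have "(LINT x|lborel. u x * v \<xi> * cis (- 2 * pi * x * \<xi>)) = fourier u \<xi> * v \<xi>" for \<xi>
  proof -
    have "(LINT x|lborel. u x * v \<xi> * cis (- 2 * pi * x * \<xi>))
        = (LINT x|lborel. u x * cis (- 2 * pi * x * \<xi>) * v \<xi>)"
      by (simp only: ac_simps)
    then show ?thesis by (simp add: fourier_cis)
  qed
  moreover have "(LINT \<xi>|lborel. u x * v \<xi> * cis (- 2 * pi * x * \<xi>)) = u x * fourier v x" for x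
    by (simp add: fourier_cis ac_simps flip: integral_mult_right_zero integral_mult_left_zero)
  ultimately show ?thesis by simp
qed

lemma fourier_shift: "fourier (\<lambda>x. f x * cis (2 * pi * s * x)) \<xi> = fourier f (\<xi> - s)"
  by (simp add: fourier_cis mult.assoc cis_mult algebra_simps)

lemma has_bochner_integral_gaussian:
  assumes "0 < a"
  shows "has_bochner_integral lborel (\<lambda>x. exp (- pi * a * x\<^sup>2)) (1 / sqrt a)"
proof -
  \<comment> \<open>Chosen so that \<open>1 / (2 * \<sigma>\<^sup>2) = pi * a\<close>; the integrand
    is then a multiple of a normal density.\<close>
  define \<sigma> where "\<sigma> = 1 / sqrt (2 * pi * a)"
  have \<sigma>: "\<sigma> > 0" "\<sigma>\<^sup>2 = 1 / (2 * pi * a)"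
    using assms by (auto simp: \<sigma>_def power_divide)
  have *: "exp (- pi * a * x\<^sup>2) = normal_density 0 \<sigma> x * (1 / sqrt a)" for x
    using assms by (simp add: normal_density_def \<sigma> real_sqrt_mult real_sqrt_divide field_simps)
  have "has_bochner_integral lborel (\<lambda>x. normal_density 0 \<sigma> x * (1 / sqrt a)) (1 * (1 / sqrt a))"
    using \<sigma> by (intro has_bochner_integral_mult_left)
      (auto simp: has_bochner_integral_iff)
  then show ?thesis using * by simp
qed

text \<open>A rescaling of the characteristic function of the standard normal distribution: the
  factor \<open>c\<close> turns the exponent of the density into \<open>pi * a * x\<^sup>2\<close>,
  and \<open>t\<close> is then fixed by matching the phases.\<close>

lemma fourier_gaussian:
  assumes a: "0 < a"
  shows "fourier (\<lambda>x. of_real (exp (- pi * a * x\<^sup>2))) \<xi> = of_real (exp (- pi * \<xi>\<^sup>2 / a) / sqrt a)"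
proof -
  define c where "c = sqrt (2 * pi * a)"
  have c: "c > 0" "c\<^sup>2 = 2 * pi * a" using a by (auto simp: c_def)
  define t where "t = - 2 * pi * \<xi> / c"
  have "of_real (exp (- (t\<^sup>2) / 2)) = char std_normal_distribution t"
    by (simp add: char_std_normal_distribution)
  also have "\<dots> = (LINT x|lborel. std_normal_density x *\<^sub>R iexp (t * x))"
    unfolding char_def by (subst integral_density) (auto simp: normal_density_nonneg)
  also have "\<dots> = c *\<^sub>R (LINT x|lborel. std_normal_density (c * x) *\<^sub>R iexp (t * (c * x)))"
    using c by (subst lborel_integral_real_affine[of c _ 0]) auto
  also have "(\<lambda>x. std_normal_density (c * x) *\<^sub>R iexp (t * (c * x)))
      = (\<lambda>x. of_real (1 / sqrt (2 * pi)) * (of_real (exp (- pi * a * x\<^sup>2)) * cis (- 2 * pi * x * \<xi>)))"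
  proof
    fix x
    have "t * (c * x) = - 2 * pi * x * \<xi>" using c by (simp add: t_def)
    moreover have "(c * x)\<^sup>2 / 2 = pi * a * x\<^sup>2" by (simp add: power_mult_distrib c)
    ultimately show "std_normal_density (c * x) *\<^sub>R iexp (t * (c * x))
      = of_real (1 / sqrt (2 * pi)) * (of_real (exp (- pi * a * x\<^sup>2)) * cis (- 2 * pi * x * \<xi>))"
      by (simp add: std_normal_density_def cis_conv_exp scaleR_conv_of_real)
  qed
  also have "c *\<^sub>R (LINT x|lborel. of_real (1 / sqrt (2 * pi)) * (of_real (exp (- pi * a * x\<^sup>2)) * cis (- 2 * pi * x * \<xi>)))
     = of_real (sqrt a) * fourier (\<lambda>x. of_real (exp (- pi * a * x\<^sup>2))) \<xi>"
    using a by (simp add: fourier_cis c_def real_sqrt_mult scaleR_conv_of_real)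
  finally have "of_real (sqrt a) * fourier (\<lambda>x. of_real (exp (- pi * a * x\<^sup>2))) \<xi> = of_real (exp (- (t\<^sup>2) / 2))" ..
  moreover have "t\<^sup>2 / 2 = pi * \<xi>\<^sup>2 / a"
    using a by (simp add: t_def power_divide power_mult_distrib c) (simp add: field_simps power2_eq_square)
  ultimately show ?thesis
    using a by (simp add: field_simps)
qed

subsection \<open>Bessel and Plancherel\<close>

text \<open>Up to reflection this is the function whose transform is the squared modulus of
  \<open>fourier u\<close>. Its value at 0 is the squared L2 norm of \<open>u\<close>, which is how
  that norm enters Bessel and Plancherel.\<close>

definition autocorr :: "(real \<Rightarrow> complex) \<Rightarrow> real \<Rightarrow> complex" where
  "autocorr u s = (LINT x|lborel. u x * cnj (u (x + s)))"

lemma integrable_power2_bounded: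
  fixes u :: "real \<Rightarrow> complex"
  assumes "integrable lborel u" "\<And>x. norm (u x) \<le> C"
  shows "integrable lborel (\<lambda>x. (norm (u x))\<^sup>2)"
proof -
  have "integrable lborel (\<lambda>x. norm (u x * u x))"
    using assms by (intro integrable_norm integrable_mult_bounded[where C = C]) auto
  then show ?thesis by (simp add: norm_mult power2_eq_square)
qed

text \<open>The product is at most the mean of the two squares, and by translation invariance both
  squares have the same integral.\<close>

lemma norm_autocorr_le:
  fixes u :: "real \<Rightarrow> complex"
  assumes u: "integrable lborel u" "\<And>x. norm (u x) \<le> C"
  shows "norm (autocorr u s) \<le> (LINT x|lborel. (norm (u x))\<^sup>2)"
proof -
  note i = integrable_power2_bounded[OF u]
  have i': "integrable lborel (\<lambda>x. (norm (u (x + s)))\<^sup>2)"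
    using lborel_integrable_real_affine[OF i, of 1 s] by (simp add: add.commute)
  have eq: "(LINT x|lborel. (norm (u (x + s)))\<^sup>2) = (LINT x|lborel. (norm (u x))\<^sup>2)"
    using lborel_integral_real_affine[of 1 "\<lambda>x. (norm (u x))\<^sup>2" s] by (simp add: add.commute)
  have "norm (autocorr u s) \<le> (LINT x|lborel. norm (u x * cnj (u (x + s))))"
    unfolding autocorr_def by (rule integral_norm_bound)
  also have "\<dots> \<le> (LINT x|lborel. ((norm (u x))\<^sup>2 + (norm (u (x + s)))\<^sup>2) / 2)"
  proof (rule integral_mono_AE')
    show "integrable lborel (\<lambda>x. ((norm (u x))\<^sup>2 + (norm (u (x + s)))\<^sup>2) / 2)"
      using i i' by simp
    have "norm (u x * cnj (u (x + s))) \<le> ((norm (u x))\<^sup>2 + (norm (u (x + s)))\<^sup>2) / 2" for x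
      using sum_squares_bound[of "norm (u x)" "norm (u (x + s))"] by (simp add: norm_mult)
    then show "AE x in lborel. norm (u x * cnj (u (x + s))) \<le> ((norm (u x))\<^sup>2 + (norm (u (x + s)))\<^sup>2) / 2"
      by simp
  qed simp
  also have "\<dots> = (LINT x|lborel. (norm (u x))\<^sup>2)"
    using i i' eq by simp
  finally show ?thesis .
qed

lemma integrable_gaussian: "0 < a \<Longrightarrow> integrable lborel (\<lambda>x. exp (- pi * a * x\<^sup>2))"
  using has_bochner_integral_gaussian by (auto simp: has_bochner_integral_iff)

lemma integral_gaussian: "0 < a \<Longrightarrow> (LINT x|lborel. exp (- pi * a * x\<^sup>2)) = 1 / sqrt a"
  using has_bochner_integral_gaussian by (auto simp: has_bochner_integral_iff)

text \<open>Applying the multiplication formula twice, first to \<open>u\<close> and the damped conjugate of its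
  transform, then to \<open>u\<close> and a modulated Gaussian, avoids a triple integral.\<close>

lemma fourier_norm_gaussian:
  assumes u: "integrable lborel u" "\<And>x. norm (u x) \<le> C" and e: "0 < e"
  shows "of_real (LINT \<xi>|lborel. (norm (fourier u \<xi>))\<^sup>2 * exp (- pi * e\<^sup>2 * \<xi>\<^sup>2))
     = (LINT t|lborel. of_real (exp (- pi * t\<^sup>2)) * autocorr u (e * t))"
proof -
  have [measurable]: "u \<in> borel_measurable borel"
    using u(1) by (auto dest: borel_measurable_integrable)
  note [measurable] = borel_measurable_fourier[of u]
  define \<gamma> where "\<gamma> t = complex_of_real (exp (- pi * t\<^sup>2))" for t :: real
  define g where "g \<xi> = complex_of_real (exp (- pi * e\<^sup>2 * \<xi>\<^sup>2))" for \<xi> :: real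
  have int_\<gamma>: "integrable lborel \<gamma>"
    using integrable_gaussian[of 1] by (simp add: \<gamma>_def[abs_def])
  have int_g: "integrable lborel g"
    using integrable_gaussian[of "e\<^sup>2"] e by (simp add: g_def[abs_def])
  have [measurable]: "\<gamma> \<in> borel_measurable borel" "g \<in> borel_measurable borel"
    unfolding \<gamma>_def[abs_def] g_def[abs_def] by measurable
  define v where "v \<xi> = g \<xi> * cnj (fourier u \<xi>)" for \<xi>
  have int_v: "integrable lborel v"
    unfolding v_def[abs_def] using int_g
    by (rule integrable_mult_bounded[where C = "LINT x|lborel. norm (u x)"]) (auto simp: norm_fourier_le)
  have fourier_v: "fourier v x = (LINT t|lborel. cnj (u (x + e * t)) * \<gamma> t)" for x
  proof -
    \<comment> \<open>Under conjugation \<open>fourier v x\<close> becomes the pairing of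
      \<open>fourier u\<close> with the modulated Gaussian \<open>h\<close>, to which the
      multiplication formula applies once more.\<close>
    define h where "h \<xi> = g \<xi> * cis (2 * pi * x * \<xi>)" for \<xi>
    have int_h: "integrable lborel h"
      unfolding h_def[abs_def] by (intro integrable_mult_cis int_g) simp
    have "fourier v x = cnj (LINT \<xi>|lborel. fourier u \<xi> * h \<xi>)"
      unfolding Bochner_Integration.integral_cnj [symmetric] fourier_cis[of v]
      by (simp add: v_def h_def g_def cis_cnj ac_simps del: Bochner_Integration.integral_cnj)
    also have "(LINT \<xi>|lborel. fourier u \<xi> * h \<xi>) = (LINT y|lborel. u y * fourier h y)"
      by (rule fourier_multiplication[OF u(1) int_h])
    \<comment> \<open>The transform of \<open>h\<close> is a Gaussian of width \<open>e\<close>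
      centred at \<open>x\<close>. This substitution makes its shape independent of \<open>e\<close>
      and moves \<open>e\<close> into the argument of \<open>u\<close>; the Jacobian cancels the
      normalising factor \<open>1 / e\<close>.\<close>
    also have "\<dots> = \<bar>e\<bar> *\<^sub>R (LINT t|lborel. u (x + e * t) * fourier h (x + e * t))"
      using e by (intro lborel_integral_real_affine) simp
    also have "\<dots> = (LINT t|lborel. u (x + e * t) * \<gamma> t)"
    proof -
      have "fourier h (x + e * t) = \<gamma> t / e" for t
      proof -
        have "fourier h (x + e * t) = fourier g (e * t)"
          unfolding h_def[abs_def] fourier_shift by simp
        also have "\<dots> = of_real (exp (- pi * (e * t)\<^sup>2 / e\<^sup>2) / sqrt (e\<^sup>2))"
          unfolding g_def[abs_def] using e by (intro fourier_gaussian) simp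
        finally show ?thesis using e by (simp add: \<gamma>_def power_mult_distrib)
      qed
      then show ?thesis using e by (simp add: scaleR_conv_of_real)
    qed
    also have "cnj \<dots> = (LINT t|lborel. cnj (u (x + e * t)) * \<gamma> t)"
      unfolding Bochner_Integration.integral_cnj [symmetric] by (simp add: \<gamma>_def del: Bochner_Integration.integral_cnj)
    finally show ?thesis .
  qed
  have "of_real (LINT \<xi>|lborel. (norm (fourier u \<xi>))\<^sup>2 * exp (- pi * e\<^sup>2 * \<xi>\<^sup>2))
      = (LINT \<xi>|lborel. fourier u \<xi> * v \<xi>)"
    by (simp add: v_def g_def complex_norm_square [unfolded of_real_power] ac_simps integral_complex_of_real [symmetric]
        del: integral_complex_of_real)
  also have "\<dots> = (LINT x|lborel. u x * fourier v x)"
    by (rule fourier_multiplication[OF u(1) int_v])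
  also have "\<dots> = (LINT x|lborel. LINT t|lborel. u x * \<gamma> t * cnj (u (x + e * t)))"
    by (simp add: fourier_v ac_simps flip: integral_mult_right_zero)
  also have "\<dots> = (LINT t|lborel. LINT x|lborel. u x * \<gamma> t * cnj (u (x + e * t)))"
    using u(2) by (intro lborel_pair.Fubini_integral[symmetric] integrable_pair_mult_bounded[OF u(1) int_\<gamma>, where C = C]) auto
  also have "\<dots> = (LINT t|lborel. \<gamma> t * autocorr u (e * t))"
    by (simp add: autocorr_def ac_simps flip: integral_mult_right_zero)
  finally show ?thesis by (simp add: \<gamma>_def)
qed

text \<open>The right-hand side of \<open>fourier_norm_gaussian\<close> averages
  \<open>autocorr u\<close> against a Gaussian of total mass 1. Continuity is not assumed, so simple
  functions are covered.\<close>

lemma fourier_norm_gaussian_le: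
  assumes u: "integrable lborel u" "\<And>x. norm (u x) \<le> C" and e: "0 < e"
  shows "(LINT \<xi>|lborel. (norm (fourier u \<xi>))\<^sup>2 * exp (- pi * e\<^sup>2 * \<xi>\<^sup>2))
     \<le> (LINT x|lborel. (norm (u x))\<^sup>2)" (is "?L \<le> ?R")
proof -
  have "?L \<le> norm (complex_of_real ?L)" by simp
  also have "\<dots> \<le> (LINT t|lborel. norm (of_real (exp (- pi * t\<^sup>2)) * autocorr u (e * t)))"
    unfolding fourier_norm_gaussian[OF u e] by (rule integral_norm_bound)
  also have "\<dots> \<le> (LINT t|lborel. exp (- pi * 1 * t\<^sup>2) * ?R)"
  proof (rule integral_mono_AE')
    show "integrable lborel (\<lambda>t. exp (- pi * 1 * t\<^sup>2) * ?R)"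
      using integrable_gaussian[of 1] by simp
  qed (auto simp: norm_mult intro!: mult_left_mono norm_autocorr_le[OF u])
  also have "\<dots> = ?R" using integral_gaussian[of 1] by simp
  finally show ?thesis .
qed

lemma exp_inverse_Suc_tendsto:
  "(\<lambda>n. exp (- pi * (c * (1 / real (Suc n)))\<^sup>2 * x)) \<longlonglongrightarrow> 1"
proof -
  have "(\<lambda>n. exp (- pi * (c * (1 / real (Suc n)))\<^sup>2 * x)) \<longlonglongrightarrow> exp (- pi * (c * 0)\<^sup>2 * x)"
    by (intro tendsto_intros LIMSEQ_Suc[OF lim_1_over_n])
  then show ?thesis by simp
qed

text \<open>Cauchy-Schwarz needs a square integrable left factor. The weight \<open>w n\<close>
  supplies it, the damped Bessel inequality bounds it uniformly in \<open>n\<close>, and boundedness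
  of \<open>fourier u\<close> together with integrability of \<open>v\<close> lets the weight tend
  to 1.\<close>

lemma fourier_bilinear_L2:
  assumes u: "integrable lborel u" "\<And>x. norm (u x) \<le> C"
    and v: "integrable lborel v" "\<And>x. norm (v x) \<le> D"
  shows "norm (LINT \<xi>|lborel. fourier u \<xi> * v \<xi>)
    \<le> sqrt (LINT x|lborel. (norm (u x))\<^sup>2) * sqrt (LINT x|lborel. (norm (v x))\<^sup>2)"
proof -
  have [measurable]: "u \<in> borel_measurable borel" "v \<in> borel_measurable borel"
    using u(1) v(1) by (auto dest: borel_measurable_integrable)
  note [measurable] = borel_measurable_fourier[of u]
  define A where "A = (LINT x|lborel. norm (u x))"
  \<comment> \<open>The factor \<open>sqrt (1 / 2)\<close> makes the square of the weight exactly
    the Gaussian of \<open>fourier_norm_gaussian_le\<close> with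
    \<open>e = 1 / Suc n\<close>.\<close>
  define w where "w n \<xi> = exp (- pi * (sqrt (1 / 2) * (1 / real (Suc n)))\<^sup>2 * \<xi>\<^sup>2)" for n \<xi>
  have w_sq: "(w n \<xi>)\<^sup>2 = exp (- pi * (1 / real (Suc n))\<^sup>2 * \<xi>\<^sup>2)" for n \<xi>
    by (simp add: w_def power_mult_distrib power_divide flip: exp_double)
  have w_le: "w n \<xi> \<le> 1" "0 \<le> w n \<xi>" for n \<xi> by (simp_all add: w_def)
  have [measurable]: "w n \<in> borel_measurable borel" for n
    unfolding w_def[abs_def] by measurable
  have "(\<lambda>n. LINT \<xi>|lborel. (fourier u \<xi> * of_real (w n \<xi>)) * v \<xi>)
      \<longlonglongrightarrow> (LINT \<xi>|lborel. (fourier u \<xi> * of_real 1) * v \<xi>)"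
  proof (rule integral_dominated_convergence[where w = "\<lambda>\<xi>. A * norm (v \<xi>)"])
    show "integrable lborel (\<lambda>\<xi>. A * norm (v \<xi>))" using v by simp
    show "AE \<xi> in lborel. (\<lambda>n. fourier u \<xi> * of_real (w n \<xi>) * v \<xi>) \<longlonglongrightarrow> fourier u \<xi> * of_real 1 * v \<xi>"
      unfolding w_def by (intro always_eventually allI tendsto_intros exp_inverse_Suc_tendsto)
    show "AE \<xi> in lborel. norm (fourier u \<xi> * of_real (w n \<xi>) * v \<xi>) \<le> A * norm (v \<xi>)" for n
    proof (intro always_eventually allI)
      fix \<xi>
      have "norm (fourier u \<xi>) * w n \<xi> \<le> A * 1"
        using w_le norm_fourier_le[of u \<xi>] order_trans[OF norm_ge_zero norm_fourier_le]
        by (intro mult_mono) (auto simp: A_def)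
      then show "norm (fourier u \<xi> * of_real (w n \<xi>) * v \<xi>) \<le> A * norm (v \<xi>)"
        using w_le by (simp add: norm_mult mult_right_mono)
    qed
  qed measurable
  then have "(\<lambda>n. norm (LINT \<xi>|lborel. (fourier u \<xi> * of_real (w n \<xi>)) * v \<xi>))
      \<longlonglongrightarrow> norm (LINT \<xi>|lborel. fourier u \<xi> * v \<xi>)"
    by (auto intro: tendsto_norm)
  then show ?thesis
  proof (rule LIMSEQ_le_const2, intro exI allI impI)
    fix n
    have sq: "(norm (fourier u \<xi> * of_real (w n \<xi>)))\<^sup>2
        = (norm (fourier u \<xi>))\<^sup>2 * exp (- pi * (1 / real (Suc n))\<^sup>2 * \<xi>\<^sup>2)" for \<xi>
      by (simp only: norm_mult power_mult_distrib w_sq[symmetric]) simp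
    have "integrable lborel (\<lambda>\<xi>. (norm (fourier u \<xi> * of_real (w n \<xi>)))\<^sup>2)"
      unfolding sq
    proof (rule Bochner_Integration.integrable_bound)
      show "integrable lborel (\<lambda>\<xi>. A\<^sup>2 * exp (- pi * (1 / real (Suc n))\<^sup>2 * \<xi>\<^sup>2))"
        by (intro integrable_mult_right integrable_gaussian) simp
      show "AE \<xi> in lborel. norm ((norm (fourier u \<xi>))\<^sup>2 * exp (- pi * (1 / real (Suc n))\<^sup>2 * \<xi>\<^sup>2))
          \<le> norm (A\<^sup>2 * exp (- pi * (1 / real (Suc n))\<^sup>2 * \<xi>\<^sup>2))"
        using norm_fourier_le[of u] by (auto simp: A_def intro!: mult_right_mono power_mono)
    qed measurable
    then have "norm (LINT \<xi>|lborel. (fourier u \<xi> * of_real (w n \<xi>)) * v \<xi>)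
      \<le> sqrt (LINT \<xi>|lborel. (norm (fourier u \<xi> * of_real (w n \<xi>)))\<^sup>2) * sqrt (LINT x|lborel. (norm (v x))\<^sup>2)"
      by (intro Cauchy_Schwarz_integral integrable_power2_bounded[OF v]) measurable
    also have "\<dots> \<le> sqrt (LINT x|lborel. (norm (u x))\<^sup>2) * sqrt (LINT x|lborel. (norm (v x))\<^sup>2)"
      unfolding sq by (intro mult_right_mono real_sqrt_le_mono fourier_norm_gaussian_le[OF u]) auto
    finally show "norm (LINT \<xi>|lborel. (fourier u \<xi> * of_real (w n \<xi>)) * v \<xi>)
      \<le> sqrt (LINT x|lborel. (norm (u x))\<^sup>2) * sqrt (LINT x|lborel. (norm (v x))\<^sup>2)" .
  qed
qed

text \<open>Let \<open>e\<close> tend to 0 in \<open>fourier_norm_gaussian\<close>. On the left,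
  \<open>fu\<close> is the majorant; on the right, continuity of \<open>u\<close> gives the limit
  \<open>autocorr u 0\<close>, the squared L2 norm.\<close>

lemma plancherel:
  assumes u: "integrable lborel u" "\<And>x. norm (u x) \<le> C" "continuous_on UNIV u"
    and fu: "integrable lborel (\<lambda>\<xi>. (norm (fourier u \<xi>))\<^sup>2)"
  shows "(LINT \<xi>|lborel. (norm (fourier u \<xi>))\<^sup>2) = (LINT x|lborel. (norm (u x))\<^sup>2)"
proof -
  have [measurable]: "u \<in> borel_measurable borel"
    using u(1) by (auto dest: borel_measurable_integrable)
  note [measurable] = borel_measurable_fourier[of u]
  define \<epsilon> where "\<epsilon> n = 1 / real (Suc n)" for n
  have \<epsilon>0: "\<epsilon> \<longlonglongrightarrow> 0" unfolding \<epsilon>_def by (rule LIMSEQ_Suc[OF lim_1_over_n])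
  have [measurable]: "autocorr u \<in> borel_measurable borel"
    unfolding autocorr_def[abs_def] by measurable
  have lim_A: "(\<lambda>n. autocorr u (\<epsilon> n * t)) \<longlonglongrightarrow> autocorr u 0" for t
    unfolding autocorr_def
  proof (rule integral_dominated_convergence[where w = "\<lambda>x. C * norm (u x)"])
    show "integrable lborel (\<lambda>x. C * norm (u x))" using u by simp
    have "(\<lambda>n. u (x + \<epsilon> n * t)) \<longlonglongrightarrow> u (x + 0 * t)" for x
      using u(3) by (intro continuous_on_tendsto_compose[of UNIV u] tendsto_intros \<epsilon>0) auto
    then show "AE x in lborel. (\<lambda>n. u x * cnj (u (x + \<epsilon> n * t))) \<longlonglongrightarrow> u x * cnj (u (x + 0))"
      by (intro always_eventually allI tendsto_intros) auto
    have "norm (u x * cnj (u y)) \<le> C * norm (u x)" for x y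
      using mult_right_mono[OF u(2)[of y] norm_ge_zero[of "u x"]] by (simp add: norm_mult mult.commute)
    then show "AE x in lborel. norm (u x * cnj (u (x + \<epsilon> n * t))) \<le> C * norm (u x)" for n
      by simp
  qed measurable
  have lim1: "(\<lambda>n. LINT t|lborel. of_real (exp (- pi * t\<^sup>2)) * autocorr u (\<epsilon> n * t))
      \<longlonglongrightarrow> (LINT t|lborel. of_real (exp (- pi * t\<^sup>2)) * autocorr u 0)"
  proof (rule integral_dominated_convergence[where w = "\<lambda>t. exp (- pi * 1 * t\<^sup>2) * (LINT x|lborel. (norm (u x))\<^sup>2)"])
    show "integrable lborel (\<lambda>t. exp (- pi * 1 * t\<^sup>2) * (LINT x|lborel. (norm (u x))\<^sup>2))"
      by (intro integrable_mult_left integrable_gaussian) simp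
    show "AE t in lborel. (\<lambda>n. of_real (exp (- pi * t\<^sup>2)) * autocorr u (\<epsilon> n * t)) \<longlonglongrightarrow> of_real (exp (- pi * t\<^sup>2)) * autocorr u 0"
      by (intro always_eventually allI tendsto_intros lim_A)
    show "AE t in lborel. norm (of_real (exp (- pi * t\<^sup>2)) * autocorr u (\<epsilon> n * t))
        \<le> exp (- pi * 1 * t\<^sup>2) * (LINT x|lborel. (norm (u x))\<^sup>2)" for n
      by (auto simp: norm_mult intro!: norm_autocorr_le[OF u(1,2)])
  qed measurable
  have lim2: "(\<lambda>n. LINT \<xi>|lborel. (norm (fourier u \<xi>))\<^sup>2 * exp (- pi * (\<epsilon> n)\<^sup>2 * \<xi>\<^sup>2))
      \<longlonglongrightarrow> (LINT \<xi>|lborel. (norm (fourier u \<xi>))\<^sup>2 * 1)"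
  proof (rule integral_dominated_convergence[where w = "\<lambda>\<xi>. (norm (fourier u \<xi>))\<^sup>2"])
    show "AE \<xi> in lborel. (\<lambda>n. (norm (fourier u \<xi>))\<^sup>2 * exp (- pi * (\<epsilon> n)\<^sup>2 * \<xi>\<^sup>2)) \<longlonglongrightarrow> (norm (fourier u \<xi>))\<^sup>2 * 1"
      using exp_inverse_Suc_tendsto[of 1] unfolding \<epsilon>_def
      by (intro always_eventually allI tendsto_intros) simp
    show "AE \<xi> in lborel. norm ((norm (fourier u \<xi>))\<^sup>2 * exp (- pi * (\<epsilon> n)\<^sup>2 * \<xi>\<^sup>2)) \<le> (norm (fourier u \<xi>))\<^sup>2" for n
      by (auto simp: mult_left_le)
  qed (use fu in measurable)
  have "(\<lambda>n. complex_of_real (LINT \<xi>|lborel. (norm (fourier u \<xi>))\<^sup>2 * exp (- pi * (\<epsilon> n)\<^sup>2 * \<xi>\<^sup>2)))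
      \<longlonglongrightarrow> of_real (LINT \<xi>|lborel. (norm (fourier u \<xi>))\<^sup>2 * 1)"
    by (intro tendsto_of_real lim2)
  also have "(\<lambda>n. complex_of_real (LINT \<xi>|lborel. (norm (fourier u \<xi>))\<^sup>2 * exp (- pi * (\<epsilon> n)\<^sup>2 * \<xi>\<^sup>2)))
     = (\<lambda>n. LINT t|lborel. of_real (exp (- pi * t\<^sup>2)) * autocorr u (\<epsilon> n * t))"
    by (intro ext fourier_norm_gaussian[OF u(1,2)]) (simp add: \<epsilon>_def)
  finally have "of_real (LINT \<xi>|lborel. (norm (fourier u \<xi>))\<^sup>2 * 1)
      = (LINT t|lborel. of_real (exp (- pi * t\<^sup>2)) * autocorr u 0)"
    using lim1 by (rule LIMSEQ_unique)
  also have "\<dots> = autocorr u 0"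
  proof -
    have "(LINT t|lborel. complex_of_real (exp (- pi * t\<^sup>2))) = 1"
      unfolding integral_complex_of_real using integral_gaussian[of 1] by simp
    then show ?thesis by simp
  qed
  also have "\<dots> = of_real (LINT x|lborel. (norm (u x))\<^sup>2)"
    by (simp add: autocorr_def complex_norm_square [unfolded of_real_power] integral_complex_of_real [symmetric] del: integral_complex_of_real)
  finally show ?thesis by (simp only: of_real_eq_iff mult_1_right)
qed

subsection \<open>Interpolation\<close>

text \<open>The family of the Riesz-Thorin argument: the modulus is raised to the complex power
  \<open>a\<close> and the phase is kept. For fixed \<open>y\<close> it is entire in
  \<open>a\<close>; the separate value at 0 keeps the support of a simple function unchanged,
  whatever \<open>a\<close> is.\<close>

definition phase_powr :: "complex \<Rightarrow> complex \<Rightarrow> complex" where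
  "phase_powr a y = (if y = 0 then 0 else exp (a * of_real (ln (norm y))) * sgn y)"

lemma phase_powr_0 [simp]: "phase_powr a 0 = 0"
  by (simp add: phase_powr_def)

lemma norm_phase_powr: "norm (phase_powr a y) = norm y powr Re a"
  by (simp add: phase_powr_def norm_mult norm_sgn powr_def)

lemma phase_powr_1: "phase_powr 1 y = y"
  by (simp add: phase_powr_def sgn_div_norm scaleR_conv_of_real flip: of_real_exp)

text \<open>Bounds all exponents occurring in the strip at once, which yields the global bound that
  the three lines theorem requires.\<close>

lemma powr_le_1_plus:
  fixes x :: real
  assumes "0 \<le> x" "0 \<le> r" "r \<le> q"
  shows "x powr r \<le> 1 + x powr q"
proof (cases "x \<le> 1")
  case True
  then have "x powr r \<le> 1" using assms by (simp add: powr_le1)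
  then show ?thesis by (simp add: add_increasing2)
next
  case False
  then have "x powr r \<le> x powr q" using assms by (intro powr_mono) auto
  then show ?thesis by simp
qed

text \<open>With \<open>h 0 = 0\<close> the level set of the value 0, which may have infinite
  measure, drops out of the sum.\<close>

lemma simple_comp_sum:
  fixes h :: "complex \<Rightarrow> complex"
  assumes "finite (range s)" "h 0 = 0"
  shows "h (s x) = (\<Sum>y\<in>range s - {0}. h y * indicator (s -` {y}) x)"
proof -
  have "(\<Sum>y\<in>range s - {0}. h y * indicator (s -` {y}) x)
      = (\<Sum>y\<in>range s - {0}. if y = s x then h y else 0)"
    by (intro sum.cong) (auto simp: indicator_def)
  also have "\<dots> = h (s x)" using assms by (auto simp: sum.delta)
  finally show ?thesis ..
qed

text \<open>Chebyshev's argument: on this level set \<open>norm (s x) / norm y\<close> equals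
  1.\<close>

lemma integrable_level_set:
  fixes s :: "real \<Rightarrow> complex"
  assumes s: "integrable lborel s" and y: "y \<noteq> 0"
  shows "integrable lborel (\<lambda>x. indicator (s -` {y}) x :: complex)"
proof (rule Bochner_Integration.integrable_bound)
  have [measurable]: "s \<in> borel_measurable borel"
    using s by (auto dest: borel_measurable_integrable)
  have "s -` {y} \<in> sets borel"
    using measurable_sets[of s borel borel "{y}"] by simp
  then show "(\<lambda>x. indicator (s -` {y}) x :: complex) \<in> borel_measurable lborel" by simp
  show "integrable lborel (\<lambda>x. norm (s x) / norm y)" using s by simp
  show "AE x in lborel. norm (indicator (s -` {y}) x :: complex) \<le> norm (norm (s x) / norm y)"
    using y by (auto simp: indicator_def)
qed

text \<open>Simple functions make the analytic family a finite exponential sum, so that no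
  differentiation under the integral sign is needed.\<close>

lemma fourier_bilinear_simple:
  fixes s t :: "real \<Rightarrow> complex"
  assumes s: "integrable lborel s" "finite (range s)"
    and t: "integrable lborel t" "finite (range t)"
    and q: "1 < q" "q < 2"
  shows "norm (LINT \<xi>|lborel. fourier s \<xi> * t \<xi>) \<le> Lq_norm q s * Lq_norm q t"
proof -
  \<comment> \<open>The real part of \<open>a\<close> is \<open>q\<close> on the left edge and
    \<open>q / 2\<close> on the right one. Hence the L1 norm on the left and the squared L2 norm on
    the right are both the integral of the q-th power of the modulus, and the edges get the bounds
    \<open>P\<close> and \<open>sqrt P\<close>.\<close>
  define a where "a z = of_real q * (1 - z / 2)" for z :: complex
  define \<Phi> where "\<Phi> z = (LINT \<xi>|lborel. fourier (\<lambda>x. phase_powr (a z) (s x)) \<xi> * phase_powr (a z) (t \<xi>))" for z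
  define c where "c y w = (LINT \<xi>|lborel. fourier (indicator (s -` {y})) \<xi> * indicator (t -` {w}) \<xi>)"
    for y w :: complex
  define S where "S = range s - {0}"
  define T where "T = range t - {0}"
  have fin: "finite S" "finite T" using s t by (auto simp: S_def T_def)
  have [measurable]: "s \<in> borel_measurable borel" "t \<in> borel_measurable borel"
    using s t by (auto dest: borel_measurable_integrable)
  have s_sum: "h (s x) = (\<Sum>y\<in>S. h y * indicator (s -` {y}) x)" if "h 0 = 0" for h :: "complex \<Rightarrow> complex" and x
    unfolding S_def using s(2) that by (rule simple_comp_sum)
  have t_sum: "h (t x) = (\<Sum>y\<in>T. h y * indicator (t -` {y}) x)" if "h 0 = 0" for h :: "complex \<Rightarrow> complex" and x
    unfolding T_def using t(2) that by (rule simple_comp_sum)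
  have int_ind_s: "integrable lborel (\<lambda>x. indicator (s -` {y}) x :: complex)" if "y \<in> S" for y
    using that s(1) by (intro integrable_level_set) (auto simp: S_def)
  have int_ind_t: "integrable lborel (\<lambda>x. indicator (t -` {y}) x :: complex)" if "y \<in> T" for y
    using that t(1) by (intro integrable_level_set) (auto simp: T_def)
  have int_s: "integrable lborel (\<lambda>x. phase_powr b (s x))" for b
    by (subst s_sum[of "phase_powr b"]) (auto intro!: Bochner_Integration.integrable_sum int_ind_s)
  have int_t: "integrable lborel (\<lambda>x. phase_powr b (t x))" for b
    by (subst t_sum[of "phase_powr b"]) (auto intro!: Bochner_Integration.integrable_sum int_ind_t)
  have fourier_s: "fourier (\<lambda>x. phase_powr b (s x)) \<xi> = (\<Sum>y\<in>S. phase_powr b y * fourier (indicator (s -` {y})) \<xi>)" for b \<xi>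
  proof -
    have "fourier (\<lambda>x. phase_powr b (s x)) \<xi>
        = (LINT x|lborel. (\<Sum>y\<in>S. phase_powr b y * (indicator (s -` {y}) x * cis (- 2 * pi * x * \<xi>))))"
      by (simp add: fourier_cis s_sum[of "phase_powr b"] sum_distrib_right mult.assoc)
    also have "\<dots> = (\<Sum>y\<in>S. (LINT x|lborel. phase_powr b y * (indicator (s -` {y}) x * cis (- 2 * pi * x * \<xi>))))"
      by (intro Bochner_Integration.integral_sum integrable_mult_right integrable_mult_cis int_ind_s) auto
    finally show ?thesis by (simp add: fourier_cis)
  qed
  have \<Phi>_sum: "\<Phi> z = (\<Sum>y\<in>S. \<Sum>w\<in>T. phase_powr (a z) y * phase_powr (a z) w * c y w)" for z
  proof -
    have int: "integrable lborel (\<lambda>\<xi>. fourier (indicator (s -` {y})) \<xi> * indicator (t -` {w}) \<xi>)"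
      if "y \<in> S" "w \<in> T" for y w
    proof -
      have "fourier (indicator (s -` {y})) \<in> borel_measurable lborel"
        using borel_measurable_fourier borel_measurable_integrable[OF int_ind_s[OF that(1)]] by simp
      from integrable_mult_bounded[OF int_ind_t[OF that(2)] this norm_fourier_le]
      show ?thesis by (simp add: mult.commute)
    qed
    have "\<Phi> z = (LINT \<xi>|lborel. (\<Sum>y\<in>S. \<Sum>w\<in>T. (phase_powr (a z) y * phase_powr (a z) w) *
        (fourier (indicator (s -` {y})) \<xi> * indicator (t -` {w}) \<xi>)))"
      unfolding \<Phi>_def fourier_s t_sum[of "phase_powr (a z)", OF phase_powr_0] sum_product
      by (simp add: ac_simps)
    also have "\<dots> = (\<Sum>y\<in>S. (LINT \<xi>|lborel. (\<Sum>w\<in>T. (phase_powr (a z) y * phase_powr (a z) w) *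
        (fourier (indicator (s -` {y})) \<xi> * indicator (t -` {w}) \<xi>))))"
      by (intro Bochner_Integration.integral_sum Bochner_Integration.integrable_sum integrable_mult_right int)
    also have "\<dots> = (\<Sum>y\<in>S. \<Sum>w\<in>T. (LINT \<xi>|lborel. (phase_powr (a z) y * phase_powr (a z) w) *
        (fourier (indicator (s -` {y})) \<xi> * indicator (t -` {w}) \<xi>)))"
      by (intro sum.cong refl Bochner_Integration.integral_sum integrable_mult_right int)
    finally show ?thesis by (simp add: c_def)
  qed
  have Is: "(LINT x|lborel. norm (s x) powr q) \<ge> 0" and It: "(LINT x|lborel. norm (t x) powr q) \<ge> 0"
    by (auto intro: integral_nonneg_AE)
  define P where "P = (LINT x|lborel. norm (s x) powr q) * (LINT x|lborel. norm (t x) powr q)"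
  have P0: "0 \<le> P" using Is It by (simp add: P_def)
  have "\<Phi> holomorphic_on UNIV"
    unfolding \<Phi>_sum[abs_def] a_def
    by (intro holomorphic_on_sum holomorphic_on_mult holomorphic_on_const)
      (auto simp: phase_powr_def S_def T_def intro!: holomorphic_intros)
  then have hol: "\<Phi> holomorphic_on A" and cont: "continuous_on A \<Phi>" for A
    by (auto intro: holomorphic_on_subset holomorphic_on_imp_continuous_on)
  have Re_a: "Re (a z) = q * (1 - Re z / 2)" for z by (simp add: a_def)
  define B where "B = (\<Sum>y\<in>S. \<Sum>w\<in>T. (1 + norm y powr q) * (1 + norm w powr q) * norm (c y w))"
  have bound: "norm (\<Phi> z) \<le> B" if "0 \<le> Re z" "Re z \<le> 1" for z
  proof -
    have "0 \<le> Re (a z)" "Re (a z) \<le> q"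
      using that q by (auto simp: Re_a mult_left_le)
    then have *: "norm (phase_powr (a z) y) \<le> 1 + norm y powr q" for y
      unfolding norm_phase_powr by (intro powr_le_1_plus) auto
    show ?thesis
      unfolding \<Phi>_sum B_def
      by (intro sum_norm_le) (auto simp: norm_mult intro!: mult_right_mono mult_mono *)
  qed
  have edge0: "norm (\<Phi> z) \<le> P" if "Re z = 0" for z
  proof -
    have nrm: "norm (phase_powr (a z) y) = norm y powr q" for y
      using that by (simp add: norm_phase_powr Re_a)
    have "norm (\<Phi> z) \<le> (LINT \<xi>|lborel. norm (fourier (\<lambda>x. phase_powr (a z) (s x)) \<xi> * phase_powr (a z) (t \<xi>)))"
      unfolding \<Phi>_def by (rule integral_norm_bound)
    also have "\<dots> \<le> (LINT \<xi>|lborel. (LINT x|lborel. norm (phase_powr (a z) (s x))) * norm (phase_powr (a z) (t \<xi>)))"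
    proof (rule integral_mono_AE')
      show "integrable lborel (\<lambda>\<xi>. (LINT x|lborel. norm (phase_powr (a z) (s x))) * norm (phase_powr (a z) (t \<xi>)))"
        using int_t by (intro integrable_mult_right integrable_norm)
    qed (auto simp: norm_mult intro!: mult_right_mono norm_fourier_le)
    also have "\<dots> = P" by (simp add: nrm P_def)
    finally show ?thesis .
  qed
  have edge1: "norm (\<Phi> z) \<le> sqrt P" if "Re z = 1" for z
  proof -
    have nrm: "(norm (phase_powr (a z) y))\<^sup>2 = norm y powr q" for y
      using that by (simp add: norm_phase_powr Re_a power2_eq_square flip: powr_add)
    have bdd: "\<exists>C. \<forall>x. norm (phase_powr (a z) (r x)) \<le> C" if "finite (range r)" for r :: "real \<Rightarrow> complex"
    proof -
      have "finite (range (\<lambda>x. phase_powr (a z) (r x)))"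
        using finite_imageI[OF that, of "phase_powr (a z)"] by (simp add: image_image)
      then have "bounded (range (\<lambda>x. phase_powr (a z) (r x)))" by (rule finite_imp_bounded)
      then show ?thesis by (auto simp: bounded_iff)
    qed
    obtain C D where "\<And>x. norm (phase_powr (a z) (s x)) \<le> C" "\<And>x. norm (phase_powr (a z) (t x)) \<le> D"
      using bdd[OF s(2)] bdd[OF t(2)] by blast
    from fourier_bilinear_L2[OF int_s this(1) int_t this(2)] show ?thesis
      by (simp add: \<Phi>_def nrm P_def real_sqrt_mult)
  qed
  \<comment> \<open>The solution of \<open>a \<theta> = 1\<close>, where the analytic family returns
    \<open>s\<close> and \<open>t\<close> themselves; \<open>1 < q < 2\<close> places it inside the
    strip. The interpolated exponent of \<open>P\<close> is
    \<open>(1 - \<theta>) + \<theta> / 2 = 1 / q\<close>.\<close>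
  define \<theta> where "\<theta> = 2 - 2 / q"
  have \<theta>: "0 \<le> \<theta>" "\<theta> \<le> 1" using q by (auto simp: \<theta>_def field_simps)
  have "a (of_real \<theta>) = 1"
    using q by (simp add: a_def \<theta>_def field_simps)
  then have \<Phi>_\<theta>: "\<Phi> (of_real \<theta>) = (LINT \<xi>|lborel. fourier s \<xi> * t \<xi>)"
    by (simp add: \<Phi>_def phase_powr_1)
  \<comment> \<open>The three lines theorem asks for positive edge bounds, but \<open>P\<close> may
    be 0; hence the shift by \<open>\<delta>\<close>, which afterwards tends to 0.\<close>
  have le: "norm (\<Phi> (of_real \<theta>)) \<le> (P + \<delta>) powr (1 / q)" if "0 < \<delta>" for \<delta>
  proof -
    have "norm (\<Phi> (of_real \<theta>)) \<le> (P + \<delta>) powr (1 - Re (of_real \<theta>)) * sqrt (P + \<delta>) powr Re (of_real \<theta>)"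
    proof (rule three_lines[OF hol cont bound])
      show "norm (\<Phi> z) \<le> P + \<delta>" if "Re z = 0" for z
        using edge0[OF that] \<open>0 < \<delta>\<close> by simp
      show "norm (\<Phi> z) \<le> sqrt (P + \<delta>)" if "Re z = 1" for z
        using edge1[OF that] \<open>0 < \<delta>\<close> by (auto intro: order_trans real_sqrt_le_mono)
    qed (use P0 \<open>0 < \<delta>\<close> \<theta> in auto)
    also have "\<dots> = (P + \<delta>) powr (1 - \<theta> / 2)"
      using P0 \<open>0 < \<delta>\<close> by (simp add: powr_half_sqrt[symmetric] powr_powr flip: powr_add)
    also have "1 - \<theta> / 2 = 1 / q" by (simp add: \<theta>_def field_simps)
    finally show ?thesis .
  qed
  have "((\<lambda>\<delta>. (P + \<delta>) powr (1 / q)) \<longlongrightarrow> (P + 0) powr (1 / q)) (at_right 0)"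
  proof (rule tendsto_powr')
    show "((\<lambda>\<delta>. P + \<delta>) \<longlongrightarrow> P + 0) (at_right 0)" by (intro tendsto_intros)
    have "\<forall>\<^sub>F \<delta> in at_right 0. 0 \<le> P + \<delta>"
      using eventually_at_right_less[of "0::real"] P0 by (auto elim: eventually_mono)
    then show "P + 0 \<noteq> 0 \<or> 0 < 1 / q \<and> (\<forall>\<^sub>F \<delta> in at_right 0. 0 \<le> P + \<delta>)" using q by simp
  qed simp
  then have "norm (\<Phi> (of_real \<theta>)) \<le> (P + 0) powr (1 / q)"
    by (rule tendsto_lowerbound) (auto intro: eventually_mono[OF eventually_at_right_less] le)
  then show ?thesis
    using Is It by (simp add: \<Phi>_\<theta> P_def Lq_norm_def powr_mult)
qed

text \<open>Simple approximants dominated by twice the function converge in every integral involved: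
  the transforms pointwise, the bilinear form, and the q-th powers.\<close>

lemma fourier_bilinear_Lq:
  fixes u v :: "real \<Rightarrow> complex"
  assumes u: "integrable lborel u" "integrable lborel (\<lambda>x. norm (u x) powr q)"
    and v: "integrable lborel v" "integrable lborel (\<lambda>x. norm (v x) powr q)"
    and q: "1 < q" "q < 2"
  shows "norm (LINT \<xi>|lborel. fourier u \<xi> * v \<xi>) \<le> Lq_norm q u * Lq_norm q v"
proof -
  have approx: "\<exists>s. (\<forall>n. integrable lborel (s n) \<and> finite (range (s n))) \<and>
      (\<forall>x. (\<lambda>n. s n x) \<longlonglongrightarrow> f x) \<and> (\<forall>n x. norm (s n x) \<le> 2 * norm (f x)) \<and>
      (\<lambda>n. Lq_norm q (s n)) \<longlonglongrightarrow> Lq_norm q f"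
    if f: "integrable lborel f" "integrable lborel (\<lambda>x. norm (f x) powr q)" for f :: "real \<Rightarrow> complex"
  proof -
    have [measurable]: "f \<in> borel_measurable lborel"
      using f(1) by (rule borel_measurable_integrable)
    from borel_measurable_implies_sequence_metric[OF this, of 0]
    obtain s where simple: "\<And>n. simple_function lborel (s n)"
      and lim: "\<And>x. (\<lambda>n. s n x) \<longlonglongrightarrow> f x" and bound: "\<And>n x. norm (s n x) \<le> 2 * norm (f x)"
      by (auto simp: dist_norm)
    have [measurable]: "s n \<in> borel_measurable lborel" for n
      using simple by (rule borel_measurable_simple_function)
    have "(\<lambda>n. LINT x|lborel. norm (s n x) powr q) \<longlonglongrightarrow> (LINT x|lborel. norm (f x) powr q)"
    proof (rule integral_dominated_convergence[where w = "\<lambda>x. 2 powr q * norm (f x) powr q"])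
      show "integrable lborel (\<lambda>x. 2 powr q * norm (f x) powr q)" using f by simp
      show "AE x in lborel. (\<lambda>n. norm (s n x) powr q) \<longlonglongrightarrow> norm (f x) powr q"
        using q by (intro always_eventually allI tendsto_powr' tendsto_norm lim tendsto_const) auto
      have "norm (s n x) powr q \<le> 2 powr q * norm (f x) powr q" for n x
        using bound[of n x] q by (auto simp flip: powr_mult intro: powr_mono2)
      then show "AE x in lborel. norm (norm (s n x) powr q) \<le> 2 powr q * norm (f x) powr q" for n
        by simp
    qed measurable
    then have "(\<lambda>n. Lq_norm q (s n)) \<longlonglongrightarrow> Lq_norm q f"
      unfolding Lq_norm_def using q
      by (intro tendsto_powr' tendsto_const) (auto intro!: always_eventually integral_nonneg_AE)
    moreover have "integrable lborel (s n)" for n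
    proof (rule Bochner_Integration.integrable_bound)
      show "integrable lborel (\<lambda>x. 2 * norm (f x))" using f by simp
    qed (auto simp: bound)
    moreover have "finite (range (s n))" for n
      using simple_functionD(1)[OF simple[of n]] by simp
    ultimately show ?thesis using lim bound by blast
  qed
  from approx[OF u] obtain s where s: "\<And>n. integrable lborel (s n)" "\<And>n. finite (range (s n))"
      "\<And>x. (\<lambda>n. s n x) \<longlonglongrightarrow> u x" "\<And>n x. norm (s n x) \<le> 2 * norm (u x)"
      "(\<lambda>n. Lq_norm q (s n)) \<longlonglongrightarrow> Lq_norm q u"
    by blast
  from approx[OF v] obtain t where t: "\<And>n. integrable lborel (t n)" "\<And>n. finite (range (t n))"
      "\<And>x. (\<lambda>n. t n x) \<longlonglongrightarrow> v x" "\<And>n x. norm (t n x) \<le> 2 * norm (v x)"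
      "(\<lambda>n. Lq_norm q (t n)) \<longlonglongrightarrow> Lq_norm q v"
    by blast
  have [measurable]: "u \<in> borel_measurable borel" "v \<in> borel_measurable borel"
    "s n \<in> borel_measurable borel" "t n \<in> borel_measurable borel" for n
    using u(1) v(1) s(1) t(1) by (auto dest: borel_measurable_integrable)
  note [measurable] = borel_measurable_fourier[of u] borel_measurable_fourier[of "s n" for n]
  have lim_f: "(\<lambda>n. fourier (s n) \<xi>) \<longlonglongrightarrow> fourier u \<xi>" for \<xi>
    unfolding fourier_cis
  proof (rule integral_dominated_convergence[where w = "\<lambda>x. 2 * norm (u x)"])
    show "integrable lborel (\<lambda>x. 2 * norm (u x))" using u by simp
    show "AE x in lborel. (\<lambda>n. s n x * cis (- 2 * pi * x * \<xi>)) \<longlonglongrightarrow> u x * cis (- 2 * pi * x * \<xi>)"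
      by (intro always_eventually allI tendsto_intros s)
  qed (auto simp: norm_mult s)
  have norm_f: "norm (fourier (s n) \<xi>) \<le> 2 * (LINT x|lborel. norm (u x))" for n \<xi>
  proof -
    have "norm (fourier (s n) \<xi>) \<le> (LINT x|lborel. norm (s n x))" by (rule norm_fourier_le)
    also have "\<dots> \<le> (LINT x|lborel. 2 * norm (u x))"
      using u by (intro integral_mono_AE') (auto simp: s)
    finally show ?thesis by simp
  qed
  have "(\<lambda>n. LINT \<xi>|lborel. fourier (s n) \<xi> * t n \<xi>) \<longlonglongrightarrow> (LINT \<xi>|lborel. fourier u \<xi> * v \<xi>)"
  proof (rule integral_dominated_convergence[where w = "\<lambda>\<xi>. 2 * (LINT x|lborel. norm (u x)) * (2 * norm (v \<xi>))"])
    show "integrable lborel (\<lambda>\<xi>. 2 * (LINT x|lborel. norm (u x)) * (2 * norm (v \<xi>)))" using v by simp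
    show "AE \<xi> in lborel. (\<lambda>n. fourier (s n) \<xi> * t n \<xi>) \<longlonglongrightarrow> fourier u \<xi> * v \<xi>"
      by (intro always_eventually allI tendsto_intros lim_f t)
    show "AE \<xi> in lborel. norm (fourier (s n) \<xi> * t n \<xi>) \<le> 2 * (LINT x|lborel. norm (u x)) * (2 * norm (v \<xi>))" for n
      unfolding norm_mult by (intro always_eventually allI mult_mono norm_f t) auto
  qed measurable
  then have "(\<lambda>n. norm (LINT \<xi>|lborel. fourier (s n) \<xi> * t n \<xi>)) \<longlonglongrightarrow> norm (LINT \<xi>|lborel. fourier u \<xi> * v \<xi>)"
    by (rule tendsto_norm)
  moreover have "(\<lambda>n. Lq_norm q (s n) * Lq_norm q (t n)) \<longlonglongrightarrow> Lq_norm q u * Lq_norm q v"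
    by (intro tendsto_mult s t)
  ultimately show ?thesis
    by (rule LIMSEQ_le) (auto intro!: exI[of _ 0] fourier_bilinear_simple s t q)
qed

subsection \<open>Schwartz functions\<close>

text \<open>One majorant that gives boundedness, integrability of all powers from 1 on, and
  vanishing at infinity. Schwartz functions and their transforms both satisfy it, so the two can be
  treated alike.\<close>

definition decays :: "(real \<Rightarrow> complex) \<Rightarrow> bool" where
  "decays g \<longleftrightarrow> g \<in> borel_measurable borel \<and> (\<exists>C. \<forall>x. norm (g x) \<le> C * inverse (1 + x\<^sup>2))"

lemma integrable_inverse_1_plus_sq: "integrable lborel (\<lambda>x::real. inverse (1 + x\<^sup>2))"
  using integrable_inverse_1_plus_square by (simp add: set_integrable_def einterval_def)

lemma inverse_1_plus_sq_bounds: "0 < inverse (1 + (x::real)\<^sup>2)" "inverse (1 + x\<^sup>2) \<le> 1"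
  by (auto simp: add_pos_nonneg intro!: inverse_le_1_iff[THEN iffD2])

lemma decays_bound:
  assumes "decays g"
  shows "\<exists>C\<ge>0. \<forall>x. norm (g x) \<le> C * inverse (1 + x\<^sup>2)"
proof -
  from assms obtain C where C: "\<And>x. norm (g x) \<le> C * inverse (1 + x\<^sup>2)"
    by (auto simp: decays_def)
  moreover have "0 \<le> C" using order_trans[OF norm_ge_zero C[of 0]] by simp
  ultimately show ?thesis by blast
qed

lemma decays_measurable: "decays g \<Longrightarrow> g \<in> borel_measurable borel"
  by (simp add: decays_def)

lemma decays_integrable:
  assumes "decays g"
  shows "integrable lborel g"
proof -
  obtain C where "0 \<le> C" and C: "\<And>x. norm (g x) \<le> C * inverse (1 + x\<^sup>2)"
    using decays_bound[OF assms(1)] by blast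
  show ?thesis
  proof (rule Bochner_Integration.integrable_bound)
    show "integrable lborel (\<lambda>x. C * inverse (1 + x\<^sup>2))"
      by (intro integrable_mult_right integrable_inverse_1_plus_sq)
    show "g \<in> borel_measurable lborel" using decays_measurable[OF assms] by simp
    show "AE x in lborel. norm (g x) \<le> norm (C * inverse (1 + x\<^sup>2))"
      using C order_trans[OF C abs_ge_self] by (auto simp del: abs_mult)
  qed
qed

lemma decays_bounded:
  assumes "decays g"
  obtains C where "\<And>x. norm (g x) \<le> C"
proof -
  obtain C where "0 \<le> C" and C: "\<And>x. norm (g x) \<le> C * inverse (1 + x\<^sup>2)"
    using decays_bound[OF assms(1)] by blast
  have "norm (g x) \<le> C" for x
    using C[of x] mult_left_mono[OF inverse_1_plus_sq_bounds(2)[of x] \<open>0 \<le> C\<close>] by simp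
  then show ?thesis using that by blast
qed

text \<open>The majorant \<open>inverse (1 + x\<^sup>2)\<close> is at most 1, so raising it to a
  power \<open>q \<ge> 1\<close> only makes it smaller.\<close>

lemma decays_integrable_powr:
  assumes "decays g" and q: "1 \<le> q"
  shows "integrable lborel (\<lambda>x. norm (g x) powr q)"
proof -
  obtain C where C0: "0 \<le> C" and C: "\<And>x. norm (g x) \<le> C * inverse (1 + x\<^sup>2)"
    using decays_bound[OF assms(1)] by blast
  have [measurable]: "g \<in> borel_measurable borel" using decays_measurable[OF assms(1)] .
  show ?thesis
  proof (rule Bochner_Integration.integrable_bound)
    show "integrable lborel (\<lambda>x. C powr q * inverse (1 + x\<^sup>2))"
      by (intro integrable_mult_right integrable_inverse_1_plus_sq)
    have "norm (g x) powr q \<le> C powr q * inverse (1 + x\<^sup>2)" for x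
    proof -
      have "norm (g x) powr q \<le> (C * inverse (1 + x\<^sup>2)) powr q"
        using C q by (intro powr_mono2) auto
      also have "\<dots> = C powr q * inverse (1 + x\<^sup>2) powr q"
        using C0 inverse_1_plus_sq_bounds[of x] by (simp add: powr_mult)
      also have "inverse (1 + x\<^sup>2) powr q \<le> inverse (1 + x\<^sup>2) powr 1"
        using inverse_1_plus_sq_bounds[of x] q by (intro powr_mono') auto
      finally show ?thesis
        using inverse_1_plus_sq_bounds[of x] by (simp add: mult_left_mono)
    qed
    then show "AE x in lborel. norm (norm (g x) powr q) \<le> norm (C powr q * inverse (1 + x\<^sup>2))"
      using inverse_1_plus_sq_bounds by (auto simp: abs_mult less_imp_le)
  qed measurable
qed

lemma decays_tendsto_0:
  assumes "decays g"
  shows "(g \<longlongrightarrow> 0) at_top" "(g \<longlongrightarrow> 0) at_bot"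
proof -
  obtain C where "0 \<le> C" and C: "\<And>x. norm (g x) \<le> C * inverse (1 + x\<^sup>2)"
    using decays_bound[OF assms(1)] by blast
  have top: "((\<lambda>x::real. inverse (1 + x\<^sup>2)) \<longlongrightarrow> 0) at_top" by real_asymp
  have bot: "((\<lambda>x::real. inverse (1 + x\<^sup>2)) \<longlongrightarrow> 0) at_bot" by real_asymp
  have "((\<lambda>x. C * inverse (1 + x\<^sup>2)) \<longlongrightarrow> 0) at_top" "((\<lambda>x. C * inverse (1 + x\<^sup>2)) \<longlongrightarrow> 0) at_bot"
    using tendsto_mult_left[OF top, of C] tendsto_mult_left[OF bot, of C] by simp_all
  then show "(g \<longlongrightarrow> 0) at_top" "(g \<longlongrightarrow> 0) at_bot"
    using C by (auto intro: Lim_null_comparison[where g = "\<lambda>x. C * inverse (1 + x\<^sup>2)"])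
qed

text \<open>Integration by parts on the whole line with vanishing boundary terms, stated for the
  derivative of the product.\<close>

lemma integral_derivative_eq_0:
  fixes F f :: "real \<Rightarrow> complex"
  assumes "\<And>x. (F has_vector_derivative f x) (at x)" "continuous_on UNIV f" "integrable lborel f"
    and "(F \<longlongrightarrow> 0) at_top" "(F \<longlongrightarrow> 0) at_bot"
  shows "(LINT x|lborel. f x) = 0"
proof -
  have "(LBINT x=-\<infinity>..\<infinity>. f x) = 0 - 0"
  proof (rule interval_integral_FTC_integrable)
    show "set_integrable lborel (einterval (-\<infinity>) \<infinity>) f"
      using assms(3) by (simp add: set_integrable_def einterval_def)
    show "((F \<circ> real_of_ereal) \<longlongrightarrow> 0) (at_right (-\<infinity>))" "((F \<circ> real_of_ereal) \<longlongrightarrow> 0) (at_left \<infinity>)"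
      using assms(4,5) by (simp_all add: ereal_tendsto_simps)
  qed (use assms in \<open>auto simp: continuous_on_eq_continuous_at\<close>)
  then show ?thesis
    by (simp add: interval_lebesgue_integral_def set_lebesgue_integral_def einterval_def)
qed

lemma iter_deriv_0 [simp]: "iter_deriv 0 f = f"
  by (simp add: iter_deriv_def)

text \<open>Peels off the derivative taken first, as closure under differentiation requires;
  \<open>iter_deriv_Suc'\<close> peels off the one taken last, as the induction for sums
  requires.\<close>

lemma iter_deriv_Suc: "iter_deriv (Suc n) f = iter_deriv n (\<lambda>x. vector_derivative f (at x))"
  by (simp add: iter_deriv_def funpow_Suc_right del: funpow.simps)

lemma iter_deriv_Suc': "iter_deriv (Suc n) f x = vector_derivative (iter_deriv n f) (at x)"
  by (simp add: iter_deriv_def)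

lemma schwartz_has_vector_derivative:
  assumes "f \<in> schwartz"
  shows "(f has_vector_derivative vector_derivative f (at x)) (at x)"
proof -
  have "iter_deriv 0 f differentiable at x" using assms unfolding schwartz_def by blast
  then show ?thesis by (simp add: vector_derivative_works)
qed

lemma schwartz_vector_derivative:
  assumes "f \<in> schwartz"
  shows "(\<lambda>x. vector_derivative f (at x)) \<in> schwartz"
proof -
  have "iter_deriv n (\<lambda>x. vector_derivative f (at x)) = iter_deriv (Suc n) f" for n
    by (rule iter_deriv_Suc[symmetric])
  then show ?thesis
    using assms unfolding schwartz_def mem_Collect_eq by presburger
qed

lemma schwartz_continuous:
  assumes "f \<in> schwartz"
  shows "continuous_on UNIV f"
  using schwartz_has_vector_derivative[OF assms]
  by (auto simp: continuous_on_eq_continuous_at intro: has_vector_derivative_continuous)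

lemma schwartz_decays:
  assumes "f \<in> schwartz"
  shows "decays (\<lambda>x. of_real (x ^ m) * f x)"
proof -
  have bdd: "\<exists>B. \<forall>x. norm (of_real (x ^ k) * f x) \<le> B" for k
  proof -
    have "bounded (range (\<lambda>x. of_real (x ^ k) * iter_deriv 0 f x))"
      using assms unfolding schwartz_def by blast
    then show ?thesis by (auto simp: bounded_iff)
  qed
  \<comment> \<open>The bounds for the powers \<open>m\<close> and \<open>m + 2\<close> add up to a
    bound for the function multiplied by \<open>1 + x\<^sup>2\<close>.\<close>
  obtain B1 where B1: "\<And>x. norm (of_real (x ^ m) * f x) \<le> B1" using bdd by blast
  obtain B2 where B2: "\<And>x. norm (of_real (x ^ (m + 2)) * f x) \<le> B2" using bdd by blast
  have "norm (of_real (x ^ m) * f x) \<le> (B1 + B2) * inverse (1 + x\<^sup>2)" for x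
  proof -
    have "norm (of_real (x ^ m) * f x) * (1 + x\<^sup>2) \<le> B1 + B2"
      using B1[of x] B2[of x] by (simp add: norm_mult norm_power algebra_simps power2_eq_square)
    then show ?thesis
      by (simp add: field_simps add_pos_nonneg)
  qed
  moreover have [measurable]: "f \<in> borel_measurable borel"
    using schwartz_continuous[OF assms] by (rule borel_measurable_continuous_onI)
  ultimately show ?thesis unfolding decays_def by (intro conjI) (measurable, blast)
qed

lemma schwartz_decays0: "f \<in> schwartz \<Longrightarrow> decays f"
  using schwartz_decays[of f 0] by simp

lemma has_vector_derivative_cis:
  "((\<lambda>x. cis (c * x)) has_vector_derivative \<i> * of_real c * cis (c * x)) (at x)"
proof -
  have "((\<lambda>z. exp (\<i> * of_real c * z)) has_field_derivative \<i> * of_real c * exp (\<i> * of_real c * of_real x)) (at (of_real x))"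
    by (auto intro!: derivative_eq_intros)
  from has_vector_derivative_real_field[OF this] show ?thesis
    by (simp add: cis_conv_exp ac_simps)
qed

lemma fourier_vector_derivative:
  assumes f: "f \<in> schwartz"
  shows "fourier (\<lambda>x. vector_derivative f (at x)) \<xi> = 2 * pi * \<i> * \<xi> * fourier f \<xi>"
proof -
  define c where "c = - 2 * pi * \<xi>"
  let ?f' = "\<lambda>x. vector_derivative f (at x)"
  note f' = schwartz_vector_derivative[OF f]
  have int: "integrable lborel (\<lambda>x. g x * cis (c * x))" if "g \<in> schwartz" for g
    using schwartz_decays0[OF that] by (intro integrable_mult_cis decays_integrable) auto
  have F: "decays (\<lambda>x. f x * cis (c * x))"
    using schwartz_decays0[OF f] by (auto simp: decays_def norm_mult)
  \<comment> \<open>The integrand is the derivative of \<open>f\<close> times the kernel, and this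
    product vanishes at both ends.\<close>
  have "(LINT x|lborel. ?f' x * cis (c * x) + f x * (\<i> * of_real c * cis (c * x))) = 0"
  proof (rule integral_derivative_eq_0[OF _ _ _ decays_tendsto_0[OF F]])
    show "((\<lambda>x. f x * cis (c * x)) has_vector_derivative
        ?f' x * cis (c * x) + f x * (\<i> * of_real c * cis (c * x))) (at x)" for x
      using has_vector_derivative_mult[OF schwartz_has_vector_derivative[OF f] has_vector_derivative_cis]
      by (simp add: add.commute)
    show "continuous_on UNIV (\<lambda>x. ?f' x * cis (c * x) + f x * (\<i> * of_real c * cis (c * x)))"
      by (intro continuous_intros schwartz_continuous f f')
    show "integrable lborel (\<lambda>x. ?f' x * cis (c * x) + f x * (\<i> * of_real c * cis (c * x)))"
      using integrable_mult_right[OF int[OF f], of "\<i> * of_real c"] int[OF f']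
      by (intro Bochner_Integration.integrable_add) (auto simp: ac_simps)
  qed
  also have "(\<lambda>x. ?f' x * cis (c * x) + f x * (\<i> * of_real c * cis (c * x)))
      = (\<lambda>x. ?f' x * cis (c * x) + (\<i> * of_real c) * (f x * cis (c * x)))"
    by (simp add: ac_simps)
  finally have "(LINT x|lborel. ?f' x * cis (c * x)) + (\<i> * of_real c) * (LINT x|lborel. f x * cis (c * x)) = 0"
    using int[OF f] int[OF f'] by simp
  moreover have "fourier g \<xi> = (LINT x|lborel. g x * cis (c * x))" for g
    by (simp add: fourier_cis c_def ac_simps)
  ultimately show ?thesis
    by (simp add: c_def add_eq_0_iff algebra_simps)
qed

text \<open>Transforming the second derivative multiplies \<open>fourier f\<close> by
  \<open>(2 * pi * \<i> * \<xi>)\<^sup>2\<close>, while the result is bounded by an L1 norm; this is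
  exactly quadratic decay, up to the constant \<open>(2 * pi)\<^sup>2 \<ge> 1\<close>.\<close>

lemma fourier_decays:
  assumes f: "f \<in> schwartz"
  shows "decays (fourier f)"
proof -
  let ?f' = "\<lambda>x. vector_derivative f (at x)"
  let ?f'' = "\<lambda>x. vector_derivative ?f' (at x)"
  note f' = schwartz_vector_derivative[OF f]
  define C where "C = (LINT x|lborel. norm (f x)) + (LINT x|lborel. norm (?f'' x))"
  have "norm (fourier f \<xi>) \<le> C * inverse (1 + \<xi>\<^sup>2)" for \<xi>
  proof -
    have "(2 * pi)\<^sup>2 * (\<xi>\<^sup>2 * norm (fourier f \<xi>)) = norm (fourier ?f'' \<xi>)"
      by (simp add: fourier_vector_derivative[OF f] fourier_vector_derivative[OF f'] norm_mult power2_eq_square)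
    also have "\<dots> \<le> (LINT x|lborel. norm (?f'' x))" by (rule norm_fourier_le)
    finally have "(2 * pi)\<^sup>2 * (\<xi>\<^sup>2 * norm (fourier f \<xi>)) \<le> (LINT x|lborel. norm (?f'' x))" .
    moreover have "1 * (\<xi>\<^sup>2 * norm (fourier f \<xi>)) \<le> (2 * pi)\<^sup>2 * (\<xi>\<^sup>2 * norm (fourier f \<xi>))"
      using pi_gt3 by (intro mult_right_mono one_le_power) auto
    ultimately have "norm (fourier f \<xi>) * (1 + \<xi>\<^sup>2) \<le> C"
      using norm_fourier_le[of f \<xi>] by (simp add: C_def algebra_simps)
    then show ?thesis by (simp add: field_simps add_pos_nonneg)
  qed
  moreover have "fourier f \<in> borel_measurable borel"
    using schwartz_continuous[OF f] by (intro borel_measurable_fourier borel_measurable_continuous_onI)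
  ultimately show ?thesis by (auto simp: decays_def)
qed

lemma norm_cis_diff_le: "norm (cis y - 1 - \<i> * of_real y) \<le> y\<^sup>2"
proof -
  have "norm (cis y - 1 - \<i> * of_real y) \<le> \<bar>y\<bar>\<^sup>2 / 2"
    using iexp_approx1[of y 1] by (simp add: cis_conv_exp diff_diff_eq numeral_2_eq_2)
  also have "\<dots> \<le> y\<^sup>2" by simp
  finally show ?thesis .
qed

text \<open>The first-order Taylor error of the kernel is quadratic in the increment, and the second
  moment of \<open>f\<close> is finite; so the remainder is at most \<open>K * h\<^sup>2\<close>.
  The formula yields the differential equation for transforms of chirps.\<close>

lemma fourier_has_vector_derivative:
  assumes f: "f \<in> schwartz"
  shows "(fourier f has_vector_derivative fourier (\<lambda>x. - 2 * pi * \<i> * x * f x) \<xi>) (at \<xi>)"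
proof -
  define f1 where "f1 x = - 2 * pi * \<i> * x * f x" for x :: real
  have [measurable]: "f \<in> borel_measurable borel"
    using schwartz_decays0[OF f] decays_measurable by blast
  have int0: "integrable lborel f"
    using schwartz_decays0[OF f] decays_integrable by blast
  have int1: "integrable lborel f1"
    using integrable_mult_right[OF decays_integrable[OF schwartz_decays[OF f, of 1]], of "- 2 * pi * \<i>"]
    by (simp add: f1_def[abs_def] ac_simps)
  have int2: "integrable lborel (\<lambda>x. x\<^sup>2 * norm (f x))"
    using integrable_norm[OF decays_integrable[OF schwartz_decays[OF f, of 2]]]
    by (simp add: norm_mult norm_power)
  \<comment> \<open>\<open>norm_cis_diff_le\<close> at \<open>y = - 2 * pi * x * h\<close>,
    integrated against \<open>norm (f x)\<close>, with \<open>h\<^sup>2\<close> taken out.\<close>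
  define K where "K = (2 * pi)\<^sup>2 * (LINT x|lborel. x\<^sup>2 * norm (f x))"
  have est: "norm (fourier f (\<xi> + h) - fourier f \<xi> - h *\<^sub>R fourier f1 \<xi>) \<le> K * h\<^sup>2" for h
  proof -
    have i0: "integrable lborel (\<lambda>x. f x * cis (- 2 * pi * x * s))" for s
      by (intro integrable_mult_cis int0) simp
    have i1: "integrable lborel (\<lambda>x. f1 x * cis (- 2 * pi * x * \<xi>))"
      by (intro integrable_mult_cis int1) simp
    have ring: "a * (E * H) - a * E - h *\<^sub>R (- 2 * pi * \<i> * x * a * E)
        = a * E * (H - 1 - \<i> * of_real (- 2 * pi * x * h))" for a E H x
      by (simp add: scaleR_conv_of_real algebra_simps)
    have "fourier f (\<xi> + h) - fourier f \<xi> - h *\<^sub>R fourier f1 \<xi>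
       = (LINT x|lborel. f x * cis (- 2 * pi * x * (\<xi> + h)) - f x * cis (- 2 * pi * x * \<xi>)
            - h *\<^sub>R (f1 x * cis (- 2 * pi * x * \<xi>)))"
      using i0 i1 by (simp only: fourier_cis Bochner_Integration.integral_diff integral_scaleR_right
          Bochner_Integration.integrable_diff integrable_scaleR_right)
    also have "\<dots> = (LINT x|lborel. f x * cis (- 2 * pi * x * \<xi>)
        * (cis (- 2 * pi * x * h) - 1 - \<i> * of_real (- 2 * pi * x * h)))"
    proof (intro Bochner_Integration.integral_cong refl)
      fix x
      have "cis (- 2 * pi * x * (\<xi> + h)) = cis (- 2 * pi * x * \<xi>) * cis (- 2 * pi * x * h)"
        by (simp add: cis_mult ring_distribs)
      then show "f x * cis (- 2 * pi * x * (\<xi> + h)) - f x * cis (- 2 * pi * x * \<xi>)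
            - h *\<^sub>R (f1 x * cis (- 2 * pi * x * \<xi>))
          = f x * cis (- 2 * pi * x * \<xi>) * (cis (- 2 * pi * x * h) - 1 - \<i> * of_real (- 2 * pi * x * h))"
        unfolding f1_def by (simp only: ring)
    qed
    finally have "norm (fourier f (\<xi> + h) - fourier f \<xi> - h *\<^sub>R fourier f1 \<xi>)
      \<le> (LINT x|lborel. norm (f x * cis (- 2 * pi * x * \<xi>)
        * (cis (- 2 * pi * x * h) - 1 - \<i> * of_real (- 2 * pi * x * h))))"
      by (simp only: integral_norm_bound)
    also have "\<dots> \<le> (LINT x|lborel. (2 * pi)\<^sup>2 * h\<^sup>2 * (x\<^sup>2 * norm (f x)))"
    proof (rule integral_mono_AE')
      show "integrable lborel (\<lambda>x. (2 * pi)\<^sup>2 * h\<^sup>2 * (x\<^sup>2 * norm (f x)))"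
        by (rule integrable_mult_right) (rule int2)
      have "norm (f x * cis (- 2 * pi * x * \<xi>) * (cis (- 2 * pi * x * h) - 1 - \<i> * of_real (- 2 * pi * x * h)))
         \<le> (2 * pi)\<^sup>2 * h\<^sup>2 * (x\<^sup>2 * norm (f x))" for x
      proof -
        have "norm (f x) * norm (cis (- 2 * pi * x * h) - 1 - \<i> * of_real (- 2 * pi * x * h))
            \<le> norm (f x) * (- 2 * pi * x * h)\<^sup>2"
          by (intro mult_left_mono norm_cis_diff_le norm_ge_zero)
        also have "\<dots> = (2 * pi)\<^sup>2 * h\<^sup>2 * (x\<^sup>2 * norm (f x))"
          by (simp add: power_mult_distrib)
        finally show ?thesis by (simp only: norm_mult norm_cis mult_1_right)
      qed
      then show "AE x in lborel. norm (f x * cis (- 2 * pi * x * \<xi>)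
          * (cis (- 2 * pi * x * h) - 1 - \<i> * of_real (- 2 * pi * x * h)))
         \<le> (2 * pi)\<^sup>2 * h\<^sup>2 * (x\<^sup>2 * norm (f x))"
        by (intro always_eventually allI)
    qed simp
    also have "\<dots> = K * h\<^sup>2" by (simp add: K_def)
    finally show ?thesis .
  qed
  have "((\<lambda>h. norm (fourier f (\<xi> + h) - fourier f \<xi> - h *\<^sub>R fourier f1 \<xi>) / norm h) \<longlongrightarrow> 0) (at 0)"
  proof (rule Lim_null_comparison[where g = "\<lambda>h. K * \<bar>h\<bar>"])
    have "((\<lambda>h::real. K * \<bar>h\<bar>) \<longlongrightarrow> K * \<bar>0\<bar>) (at 0)" by (intro tendsto_intros)
    then show "((\<lambda>h::real. K * \<bar>h\<bar>) \<longlongrightarrow> 0) (at 0)" by simp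
    have "norm (norm (fourier f (\<xi> + h) - fourier f \<xi> - h *\<^sub>R fourier f1 \<xi>) / norm h) \<le> K * \<bar>h\<bar>"
      if "h \<noteq> 0" for h
      using est[of h] that by (simp add: divide_le_eq power2_eq_square mult.assoc)
    then show "\<forall>\<^sub>F h in at 0. norm (norm (fourier f (\<xi> + h) - fourier f \<xi> - h *\<^sub>R fourier f1 \<xi>) / norm h) \<le> K * \<bar>h\<bar>"
      by (auto simp: eventually_at_filter)
  qed
  then show ?thesis
    unfolding has_vector_derivative_def has_derivative_at f1_def by (simp add: bounded_linear_scaleR_left)
qed

subsection \<open>The lower bound for exponents below two\<close>

lemma Lq_norm_2: "Lq_norm 2 f = sqrt (LINT x|lborel. (norm (f x))\<^sup>2)"
  by (simp add: Lq_norm_def powr_half_sqrt integral_nonneg_AE)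

text \<open>For each exponent the integral vanishes only if the function vanishes almost everywhere,
  so non-vanishing passes from exponent 2 to exponent \<open>q\<close>.\<close>

lemma Lq_norm_pos:
  assumes "decays g" "1 \<le> q" "(LINT x|lborel. (norm (g x))\<^sup>2) \<noteq> 0"
  shows "0 < Lq_norm q g"
proof -
  have "(LINT x|lborel. norm (g x) powr q) \<noteq> 0"
  proof
    assume "(LINT x|lborel. norm (g x) powr q) = 0"
    then have "AE x in lborel. norm (g x) powr q = 0"
      using decays_integrable_powr[OF assms(1,2)] by (subst (asm) integral_nonneg_eq_0_iff_AE) auto
    then have "AE x in lborel. (norm (g x))\<^sup>2 = 0" by simp
    then have "(LINT x|lborel. (norm (g x))\<^sup>2) = 0" by (rule integral_eq_zero_AE)
    with assms(3) show False ..
  qed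
  moreover have "(LINT x|lborel. norm (g x) powr q) \<ge> 0" by (intro integral_nonneg_AE) auto
  ultimately show ?thesis by (simp add: Lq_norm_def)
qed

lemma decays_integrable_power2: "decays g \<Longrightarrow> integrable lborel (\<lambda>x. (norm (g x))\<^sup>2)"
  using decays_integrable_powr[of g 2] by simp

text \<open>By continuity the set where \<open>f\<close> differs from 0 is open, and a nonempty open
  set is not negligible.\<close>

lemma continuous_integral_power2_nonzero:
  fixes f :: "real \<Rightarrow> complex"
  assumes cont: "continuous_on UNIV f" and int: "integrable lborel (\<lambda>x. (norm (f x))\<^sup>2)"
    and nz: "f x \<noteq> 0"
  shows "(LINT x|lborel. (norm (f x))\<^sup>2) \<noteq> 0"
proof
  assume "(LINT x|lborel. (norm (f x))\<^sup>2) = 0"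
  then have "AE x in lborel. (norm (f x))\<^sup>2 = 0"
    using int by (subst (asm) integral_nonneg_eq_0_iff_AE) auto
  then have "AE x in lborel. x \<notin> {x. f x \<noteq> 0}" by simp
  moreover have op: "open {x. f x \<noteq> 0}"
    using cont by (intro open_Collect_neq continuous_on_const) auto
  ultimately have "{x. f x \<noteq> 0} \<in> null_sets lborel"
    by (subst AE_iff_null_sets) auto
  then have "negligible {x. f x \<noteq> 0}"
    by (simp add: negligible_iff_null_sets null_sets_completionI)
  then show False using open_not_negligible[OF op] nz by auto
qed

lemma schwartz_plancherel:
  assumes "f \<in> schwartz"
  shows "(LINT \<xi>|lborel. (norm (fourier f \<xi>))\<^sup>2) = (LINT x|lborel. (norm (f x))\<^sup>2)"
proof -
  note f = schwartz_decays0[OF assms]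
  from decays_bounded[OF f] obtain C where C: "\<And>x. norm (f x) \<le> C" by blast
  show ?thesis
    by (rule plancherel[OF decays_integrable[OF f] C schwartz_continuous[OF assms]
          decays_integrable_power2[OF fourier_decays[OF assms]]])
qed

lemma schwartz_integral_power2_nonzero:
  assumes "f \<in> schwartz" "f \<noteq> (\<lambda>x. 0)"
  shows "(LINT x|lborel. (norm (f x))\<^sup>2) \<noteq> 0"
  using assms continuous_integral_power2_nonzero[OF schwartz_continuous
      decays_integrable_power2[OF schwartz_decays0]] by (auto simp: fun_eq_iff)

lemma Fq_pos:
  assumes "f \<in> schwartz" "f \<noteq> (\<lambda>x. 0)" "1 \<le> q"
  shows "0 < Fq q f"
proof -
  have "0 < Lq_norm p f" "0 < Lq_norm p (fourier f)" if "1 \<le> p" for p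
    using that schwartz_integral_power2_nonzero[OF assms(1,2)] schwartz_plancherel[OF assms(1)]
      schwartz_decays0[OF assms(1)] fourier_decays[OF assms(1)] by (auto intro!: Lq_norm_pos)
  from this[OF assms(3)] this[of 2] show ?thesis by (simp add: Fq_def)
qed

lemma Fq_ge_1:
  assumes f: "f \<in> schwartz" "f \<noteq> (\<lambda>x. 0)" and q: "1 < q" "q < 2"
  shows "1 \<le> Fq q f"
proof -
  note df = schwartz_decays0[OF f(1)] and dF = fourier_decays[OF f(1)]
  define I where "I = (LINT \<xi>|lborel. (norm (fourier f \<xi>))\<^sup>2)"
  have I: "0 \<le> I" "I \<noteq> 0"
    using schwartz_integral_power2_nonzero[OF f] schwartz_plancherel[OF f(1)]
    by (auto simp: I_def intro: integral_nonneg_AE)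
  have dF': "decays (\<lambda>\<xi>. cnj (fourier f \<xi>))"
    using dF unfolding decays_def by (auto intro: measurable_compose)
  have "complex_of_real I = (LINT \<xi>|lborel. fourier f \<xi> * cnj (fourier f \<xi>))"
    unfolding I_def integral_complex_of_real[symmetric] by (simp only: complex_norm_square)
  then have "I = norm (LINT \<xi>|lborel. fourier f \<xi> * cnj (fourier f \<xi>))"
    using I by (metis abs_of_nonneg norm_of_real)
  also have "\<dots> \<le> Lq_norm q f * Lq_norm q (\<lambda>\<xi>. cnj (fourier f \<xi>))"
    using q df dF' by (intro fourier_bilinear_Lq decays_integrable decays_integrable_powr) auto
  also have "\<dots> = Lq_norm q f * Lq_norm q (fourier f)" by (simp add: Lq_norm_def)
  finally have "I \<le> Lq_norm q f * Lq_norm q (fourier f)" .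
  \<comment> \<open>By Plancherel the denominator of \<open>Fq\<close> is the same number
    \<open>I\<close>.\<close>
  moreover have "Lq_norm 2 f * Lq_norm 2 (fourier f) = I"
    using I by (simp add: Lq_norm_2 I_def schwartz_plancherel[OF f(1)])
  ultimately show ?thesis using I by (simp add: Fq_def)
qed

subsection \<open>Chirped Gaussians\<close>

text \<open>The imaginary part of \<open>z\<close> is the chirp rate. It is invisible in the modulus
  and hence in the norms of \<open>gauss z\<close>, and acts only on the transform, through
  \<open>1 / z\<close>.\<close>

definition gauss :: "complex \<Rightarrow> real \<Rightarrow> complex" where
  "gauss z x = exp (- (of_real pi * z * (of_real x)\<^sup>2))"

lemma norm_gauss: "norm (gauss z x) = exp (- pi * Re z * x\<^sup>2)"
  by (simp add: gauss_def flip: of_real_power)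

section \<open>Polynomial multiples of Gaussians as Schwartz functions\<close>

text \<open>A single term of the exponential series is at most the whole sum.\<close>

lemma power_le_fact_exp:
  fixes y :: real
  assumes "0 \<le> y"
  shows "y ^ m \<le> fact m * exp y"
proof -
  have "(\<Sum>n\<in>{m}. y ^ n /\<^sub>R fact n) \<le> (\<Sum>n. y ^ n /\<^sub>R fact n)"
    using assms by (intro sum_le_suminf sums_summable[OF exp_converges]) auto
  then have "y ^ m /\<^sub>R fact m \<le> exp y" by (simp only: exp_def sum.insert_remove sum.empty) simp
  then show ?thesis by (simp add: field_simps)
qed

lemma power_gauss_bounded:
  assumes "0 < Re z"
  shows "bounded (range (\<lambda>x. of_real (x ^ m) * gauss z x))"
proof -
  define a where "a = pi * Re z"
  have a: "0 < a" using assms by (simp add: a_def)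
  have "norm (of_real (x ^ m) * gauss z x) \<le> 1 + fact m / a ^ m" for x
  proof -
    have "0 \<le> \<bar>x\<bar> ^ m" by simp
    \<comment> \<open>Passing to the square turns the power of \<open>\<bar>x\<bar>\<close>,
      possibly odd, into a power of \<open>x\<^sup>2\<close>, which can be compared with the
      exponential.\<close>
    then have "\<bar>x\<bar> ^ m \<le> 1 + (\<bar>x\<bar> ^ m)\<^sup>2"
      using sum_squares_bound[of "\<bar>x\<bar> ^ m" 1] unfolding mult_1_right one_power2 by linarith
    also have "(\<bar>x\<bar> ^ m)\<^sup>2 = (x\<^sup>2) ^ m"
      by (metis power2_abs power_mult mult.commute)
    also have "(x\<^sup>2) ^ m = (a * x\<^sup>2) ^ m / a ^ m" using a by (simp add: power_mult_distrib)
    also have "\<dots> \<le> fact m * exp (a * x\<^sup>2) / a ^ m"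
      using a by (intro divide_right_mono power_le_fact_exp) auto
    finally have "\<bar>x\<bar> ^ m * exp (- (a * x\<^sup>2)) \<le> (1 + fact m * exp (a * x\<^sup>2) / a ^ m) * exp (- (a * x\<^sup>2))"
      by (intro mult_right_mono) auto
    also have "\<dots> = exp (- (a * x\<^sup>2)) + fact m / a ^ m"
      by (simp add: ring_distribs exp_minus field_simps)
    also have "\<dots> \<le> 1 + fact m / a ^ m" using a by simp
    finally show ?thesis by (simp add: norm_mult norm_gauss norm_power a_def power_abs)
  qed
  then show ?thesis by (auto simp: bounded_iff)
qed

text \<open>The induction follows Horner's scheme: splitting off the constant coefficient leaves a
  factor \<open>x\<close>, so the exponent \<open>m\<close> has to vary.\<close>

lemma poly_gauss_bounded:
  assumes "0 < Re z"
  shows "bounded (range (\<lambda>x. of_real (x ^ m) * (poly p (of_real x) * gauss z x)))"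
proof (induction p arbitrary: m)
  case 0
  then show ?case by simp
next
  case (pCons a p)
  have "bounded (range (\<lambda>x. a * (of_real (x ^ m) * gauss z x)))"
    using bounded_linear_image[OF power_gauss_bounded[OF assms, of m] bounded_linear_mult_right[of a]]
    by (simp add: image_image)
  from bounded_plus_comp[OF this pCons.IH[of "Suc m"]]
  show ?case by (simp add: algebra_simps)
qed

text \<open>Polynomial multiples of one fixed Gaussian are closed under differentiation, so all
  iterated derivatives stay in this class.\<close>

lemma poly_gauss_has_vector_derivative:
  "((\<lambda>x. poly p (of_real x) * gauss z x) has_vector_derivative
     poly (pderiv p - [:0, 2 * of_real pi * z:] * p) (of_real x) * gauss z x) (at x)"
proof -
  have "((\<lambda>w. poly p w * exp (- (of_real pi * z * w\<^sup>2))) has_field_derivative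
     poly (pderiv p - [:0, 2 * of_real pi * z:] * p) (of_real x) * exp (- (of_real pi * z * (of_real x)\<^sup>2))) (at (of_real x))"
    by (rule derivative_eq_intros poly_DERIV refl)+ (simp add: algebra_simps)
  from has_vector_derivative_real_field[OF this] show ?thesis by (simp add: gauss_def)
qed

lemma iter_deriv_poly_gauss:
  "\<exists>r. iter_deriv n (\<lambda>x. poly p (of_real x) * gauss z x) = (\<lambda>x. poly r (of_real x) * gauss z x)"
proof (induction n arbitrary: p)
  case 0
  then show ?case by auto
next
  case (Suc n)
  have "(\<lambda>x. vector_derivative (\<lambda>x. poly p (of_real x) * gauss z x) (at x))
      = (\<lambda>x. poly (pderiv p - [:0, 2 * of_real pi * z:] * p) (of_real x) * gauss z x)"
    by (intro ext vector_derivative_at poly_gauss_has_vector_derivative)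
  then show ?case unfolding iter_deriv_Suc by (simp only: Suc)
qed

lemma poly_gauss_schwartz:
  assumes "0 < Re z"
  shows "(\<lambda>x. poly p (of_real x) * gauss z x) \<in> schwartz"
  unfolding schwartz_def
proof (intro CollectI conjI allI)
  fix n x
  obtain r where r: "iter_deriv n (\<lambda>x. poly p (of_real x) * gauss z x) = (\<lambda>x. poly r (of_real x) * gauss z x)"
    using iter_deriv_poly_gauss by blast
  show "iter_deriv n (\<lambda>x. poly p (of_real x) * gauss z x) differentiable at x"
    unfolding r using poly_gauss_has_vector_derivative by (rule differentiableI_vector)
next
  fix m n
  obtain r where r: "iter_deriv n (\<lambda>x. poly p (of_real x) * gauss z x) = (\<lambda>x. poly r (of_real x) * gauss z x)"
    using iter_deriv_poly_gauss by blast
  show "bounded (range (\<lambda>x. of_real (x ^ m) * iter_deriv n (\<lambda>x. poly p (of_real x) * gauss z x) x))"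
    unfolding r using assms by (rule poly_gauss_bounded)
qed

lemma gauss_schwartz: "0 < Re z \<Longrightarrow> gauss z \<in> schwartz"
  using poly_gauss_schwartz[of z 1] by simp

lemma cmult_gauss_schwartz: "0 < Re z \<Longrightarrow> (\<lambda>x. c * gauss z x) \<in> schwartz"
  using poly_gauss_schwartz[of z "[:c:]"] by simp

lemma schwartz_add:
  assumes f: "f \<in> schwartz" and g: "g \<in> schwartz"
  shows "(\<lambda>x. f x + g x) \<in> schwartz"
proof -
  have diff: "iter_deriv n h differentiable at x" if "h \<in> schwartz" for h n x
    using that by (simp add: schwartz_def)
  have eq: "iter_deriv n (\<lambda>x. f x + g x) = (\<lambda>x. iter_deriv n f x + iter_deriv n g x)" for n
  proof (induction n)
    case (Suc n)
    have "vector_derivative (\<lambda>x. iter_deriv n f x + iter_deriv n g x) (at x)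
        = vector_derivative (iter_deriv n f) (at x) + vector_derivative (iter_deriv n g) (at x)" for x
      using diff[OF f] diff[OF g]
      by (intro vector_derivative_at has_vector_derivative_add) (simp_all add: vector_derivative_works[symmetric])
    then show ?case by (auto simp: iter_deriv_Suc' Suc)
  qed simp
  have "iter_deriv n (\<lambda>x. f x + g x) differentiable at x" for n x
    unfolding eq by (intro differentiable_add diff f g)
  moreover have "bounded (range (\<lambda>x. of_real (x ^ m) * iter_deriv n (\<lambda>x. f x + g x) x))" for m n
    unfolding eq distrib_left using f g by (intro bounded_plus_comp) (auto simp: schwartz_def)
  ultimately show ?thesis by (simp add: schwartz_def)
qed

text \<open>The transform satisfies the same first-order equation as \<open>gauss (1 / z)\<close>; the constant is not
  computed, since it cancels in the quotient.\<close>

lemma fourier_gauss: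
  assumes z: "0 < Re z"
  obtains C where "C \<noteq> 0" "\<And>\<xi>. fourier (gauss z) \<xi> = C * gauss (1 / z) \<xi>"
proof -
  have z0: "z \<noteq> 0" using z by auto
  have S: "gauss z \<in> schwartz" using gauss_schwartz[OF z] .
  have d_gauss: "(gauss w has_vector_derivative - (2 * of_real pi * w * of_real x) * gauss w x) (at x)" for w x
    using poly_gauss_has_vector_derivative[of 1 w x] by (simp add: algebra_simps)
  \<comment> \<open>Multiplication by \<open>x\<close> is, up to a constant, differentiation of
    \<open>gauss z\<close>; its transform is therefore again a multiple of \<open>\<xi>\<close>
    times the transform.\<close>
  have "fourier (\<lambda>x. - 2 * pi * \<i> * x * gauss z x) \<xi> = - (2 * pi * \<xi> / z) * fourier (gauss z) \<xi>" for \<xi>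
  proof -
    have "(\<lambda>x. - 2 * pi * \<i> * x * gauss z x) = (\<lambda>x. \<i> / z * vector_derivative (gauss z) (at x))"
    proof
      fix x
      have "vector_derivative (gauss z) (at x) = - (2 * of_real pi * z * of_real x) * gauss z x"
        by (intro vector_derivative_at d_gauss)
      then show "- 2 * pi * \<i> * x * gauss z x = \<i> / z * vector_derivative (gauss z) (at x)"
        using z0 by simp
    qed
    then have "fourier (\<lambda>x. - 2 * pi * \<i> * x * gauss z x) \<xi>
        = \<i> / z * fourier (\<lambda>x. vector_derivative (gauss z) (at x)) \<xi>"
      by (simp add: fourier_cis mult.assoc)
    also have "\<dots> = - (2 * pi * \<xi> / z) * fourier (gauss z) \<xi>"
      by (simp add: fourier_vector_derivative[OF S] ac_simps)
    finally show ?thesis .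
  qed
  then have d_fourier: "(fourier (gauss z) has_vector_derivative - (2 * pi * \<xi> / z) * fourier (gauss z) \<xi>) (at \<xi>)" for \<xi>
    using fourier_has_vector_derivative[OF S, of \<xi>] by simp
  \<comment> \<open>\<open>gauss (- 1 / z)\<close> is the reciprocal of
    \<open>gauss (1 / z)\<close>, so \<open>h\<close> is the quotient of two solutions of the same
    linear equation and hence constant.\<close>
  define h where "h \<xi> = fourier (gauss z) \<xi> * gauss (- 1 / z) \<xi>" for \<xi>
  have "(h has_vector_derivative 0) (at \<xi>)" for \<xi>
    unfolding h_def[abs_def]
    using has_vector_derivative_mult[OF d_fourier[of \<xi>] d_gauss[of "- 1 / z" \<xi>]] by (simp add: algebra_simps)
  then obtain C where C: "\<And>\<xi>. h \<xi> = C"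
    using has_vector_derivative_zero_constant[of UNIV h] by (metis UNIV_I convex_UNIV)
  have inv: "gauss (- 1 / z) \<xi> * gauss (1 / z) \<xi> = 1" for \<xi>
    by (simp add: gauss_def flip: exp_add)
  have eq: "fourier (gauss z) \<xi> = C * gauss (1 / z) \<xi>" for \<xi>
    using C[of \<xi>] inv[of \<xi>] unfolding h_def by (metis mult.assoc mult_1_right)
  moreover have "C \<noteq> 0"
  proof
    assume "C = 0"
    then have "fourier (gauss z) = (\<lambda>x. 0)" using eq by auto
    then have "(LINT x|lborel. (norm (gauss z x))\<^sup>2) = 0"
      using schwartz_plancherel[OF S] by simp
    moreover have "gauss z \<noteq> (\<lambda>x. 0)" by (auto simp: gauss_def fun_eq_iff)
    ultimately show False using schwartz_integral_power2_nonzero[OF S] by simp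
  qed
  ultimately show ?thesis using that by blast
qed

lemma Lq_norm_cmult:
  assumes "0 < q"
  shows "Lq_norm q (\<lambda>x. c * f x) = norm c * Lq_norm q f"
  using assms
  by (simp add: Lq_norm_def norm_mult powr_mult powr_powr integral_nonneg_AE)

lemma Lq_norm_gauss:
  assumes "0 < Re z" "0 < q"
  shows "Lq_norm q (gauss z) = (q * Re z) powr (- 1 / (2 * q))"
proof -
  have "norm (gauss z x) powr q = exp (- pi * (q * Re z) * x\<^sup>2)" for x
    by (simp add: norm_gauss powr_def ac_simps)
  then have "Lq_norm q (gauss z) = (1 / sqrt (q * Re z)) powr (1 / q)"
    using assms integral_gaussian[of "q * Re z"] by (simp add: Lq_norm_def)
  also have "1 / sqrt (q * Re z) = (q * Re z) powr (- 1 / 2)"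
    using assms by (simp add: powr_minus_divide powr_half_sqrt)
  finally show ?thesis using assms by (simp add: powr_powr)
qed

text \<open>Since \<open>Re (1 / z) = 1 / (1 + s\<^sup>2)\<close>, the chirp widens the transform
  without touching the modulus of the function. The last exponent is the difference between the
  scaling exponents of the L^q and L2 norms; it is positive exactly when
  \<open>q > 2\<close>.\<close>

lemma Fq_chirp:
  assumes q: "0 < q"
  shows "Fq q (gauss (1 + \<i> * of_real s))
     = sqrt 2 * q powr (- 1 / q) * (1 / (1 + s\<^sup>2)) powr (1 / 4 - 1 / (2 * q))"
proof -
  define z where "z = 1 + \<i> * of_real s"
  have z: "0 < Re z" by (simp add: z_def)
  define r where "r = 1 / (1 + s\<^sup>2)"
  have r: "0 < r" by (simp add: r_def add_pos_nonneg)
  have Re_inv: "Re (1 / z) = r" by (simp add: z_def r_def Re_divide power2_eq_square)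
  obtain C where C: "C \<noteq> 0" "\<And>\<xi>. fourier (gauss z) \<xi> = C * gauss (1 / z) \<xi>"
    using fourier_gauss[OF z] by blast
  have F: "fourier (gauss z) = (\<lambda>\<xi>. C * gauss (1 / z) \<xi>)" using C by auto
  have N: "Lq_norm p (gauss z) * Lq_norm p (fourier (gauss z)) = norm C * (p powr (- 1 / p) * r powr (- 1 / (2 * p)))"
    if "0 < p" for p
  proof -
    have "Lq_norm p (gauss z) = p powr (- 1 / (2 * p))"
      using that z by (simp add: Lq_norm_gauss) (simp add: z_def)
    moreover have "Lq_norm p (fourier (gauss z)) = norm C * (p powr (- 1 / (2 * p)) * r powr (- 1 / (2 * p)))"
      unfolding F using that r by (simp add: Lq_norm_cmult Lq_norm_gauss Re_inv powr_mult)
    moreover have "p powr (- 1 / (2 * p)) * p powr (- 1 / (2 * p)) = p powr (- 1 / p)"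
      by (simp flip: powr_add)
    ultimately show ?thesis by (metis mult.assoc mult.left_commute)
  qed
  have "Fq q (gauss z) = (q powr (- 1 / q) * r powr (- 1 / (2 * q))) / (2 powr (- 1 / 2) * r powr (- 1 / 4))"
    unfolding Fq_def N[OF q] using N[of 2] C by simp
  also have "\<dots> = sqrt 2 * q powr (- 1 / q) * r powr (1 / 4 - 1 / (2 * q))"
  proof -
    have "(2::real) powr (- 1 / 2) = 1 / sqrt 2" by (simp add: powr_minus_divide powr_half_sqrt)
    moreover have "r powr (1 / 4 - 1 / (2 * q)) = r powr (- 1 / (2 * q)) / r powr (- 1 / 4)"
      by (simp flip: powr_diff)
    ultimately show ?thesis by simp
  qed
  finally show ?thesis by (simp add: z_def r_def)
qed

lemma chirp_Fq_image:
  assumes q: "2 < q" and v: "0 < v" "v \<le> sqrt 2 * q powr (- 1 / q)"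
  shows "v \<in> Fq q ` (schwartz - {\<lambda>x. 0})"
proof -
  define c where "c = sqrt 2 * q powr (- 1 / q)"
  define k where "k = 1 / 4 - 1 / (2 * q)"
  \<comment> \<open>\<open>r\<close> solves \<open>c * r powr k = v\<close> and \<open>s\<close>
    solves \<open>1 / (1 + s\<^sup>2) = r\<close>; the condition \<open>v \<le> c\<close> makes
    \<open>r \<le> 1\<close>, so that the root is real.\<close>
  define r where "r = (v / c) powr (1 / k)"
  define s where "s = sqrt (1 / r - 1)"
  have c: "0 < c" using q by (simp add: c_def)
  have k: "0 < k" using q by (simp add: k_def field_simps)
  have "v \<le> c" using v by (simp add: c_def)
  then have r: "0 < r" "r \<le> 1"
    using v(1) c k by (auto simp: r_def intro!: powr_le1)
  then have "1 + s\<^sup>2 = 1 / r" by (simp add: s_def)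
  then have "Fq q (gauss (1 + \<i> * of_real s)) = c * r powr k"
    using q by (simp add: Fq_chirp c_def k_def)
  also have "\<dots> = v" using v c k by (simp add: r_def powr_powr)
  finally have "Fq q (gauss (1 + \<i> * of_real s)) = v" .
  moreover have "gauss (1 + \<i> * of_real s) \<in> schwartz" by (intro gauss_schwartz) simp
  moreover have "gauss (1 + \<i> * of_real s) \<noteq> (\<lambda>x. 0)" by (auto simp: gauss_def fun_eq_iff)
  ultimately show ?thesis by blast
qed

subsection \<open>Superposition of a wide and a narrow Gaussian\<close>

text \<open>The powers of \<open>b\<close> give the two terms the same L2 norm, independent of
  \<open>b\<close>. The function is real and positive, so the modulus disappears from the norms and
  dropping a term gives a lower bound.\<close>

definition two_scale :: "real \<Rightarrow> real \<Rightarrow> real" where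
  "two_scale b x = b powr (- 1 / 4) * exp (- pi * (1 / b) * x\<^sup>2) + b powr (1 / 4) * exp (- pi * b * x\<^sup>2)"

lemma two_scale_pos: "0 < b \<Longrightarrow> 0 < two_scale b x"
  by (simp add: two_scale_def add_pos_pos)

lemma borel_measurable_two_scale [measurable]: "two_scale b \<in> borel_measurable borel"
  unfolding two_scale_def[abs_def] by measurable

lemma gauss_of_real: "gauss (of_real b) x = of_real (exp (- pi * b * x\<^sup>2))"
  by (simp add: gauss_def flip: exp_of_real)

lemma two_scale_schwartz:
  assumes b: "0 < b"
  shows "(\<lambda>x. of_real (two_scale b x)) \<in> schwartz"
proof -
  have "(\<lambda>x. of_real (b powr (- 1 / 4)) * gauss (of_real (1 / b)) x
      + of_real (b powr (1 / 4)) * gauss (of_real b) x) \<in> schwartz"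
    using b by (intro schwartz_add cmult_gauss_schwartz) (simp_all del: of_real_divide)
  then show ?thesis by (simp add: two_scale_def gauss_of_real del: of_real_divide)
qed

text \<open>The transform exchanges the two terms: the factor \<open>sqrt b\<close> that it
  produces, or its inverse, turns \<open>b powr (- 1 / 4)\<close> and \<open>b powr (1 / 4)\<close>
  into each other.\<close>

lemma fourier_two_scale:
  assumes b: "0 < b"
  shows "fourier (\<lambda>x. of_real (two_scale b x)) = (\<lambda>x. of_real (two_scale b x))"
proof
  fix \<xi>
  define g where "g a x = complex_of_real (exp (- pi * a * x\<^sup>2))" for a x :: real
  have int: "integrable lborel (\<lambda>x. c * (g a x * cis (- 2 * pi * x * \<xi>)))" if "0 < a" for a c
    using integrable_gaussian[OF that] unfolding g_def
    by (intro integrable_mult_right integrable_mult_cis) auto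
  have F: "fourier (g a) \<xi> = of_real (exp (- pi * (1 / a) * \<xi>\<^sup>2) / sqrt a)" if "0 < a" for a
    using fourier_gaussian[OF that, of \<xi>] by (simp add: g_def[abs_def])
  have "fourier (\<lambda>x. of_real (two_scale b x)) \<xi>
      = (LINT x|lborel. of_real (b powr (- 1 / 4)) * (g (1 / b) x * cis (- 2 * pi * x * \<xi>))
          + of_real (b powr (1 / 4)) * (g b x * cis (- 2 * pi * x * \<xi>)))"
    unfolding fourier_cis two_scale_def g_def
    by (simp only: of_real_add of_real_mult distrib_right mult.assoc)
  also have "\<dots> = of_real (b powr (- 1 / 4)) * fourier (g (1 / b)) \<xi> + of_real (b powr (1 / 4)) * fourier (g b) \<xi>"
    using int[of "1 / b" "of_real (b powr (- 1 / 4))"] int[of b "of_real (b powr (1 / 4))"] b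
    by (simp add: fourier_cis)
  also have "\<dots> = of_real (b powr (- 1 / 4) * sqrt b * exp (- pi * b * \<xi>\<^sup>2)
      + b powr (1 / 4) / sqrt b * exp (- pi * (1 / b) * \<xi>\<^sup>2))"
    using b by (simp add: F real_sqrt_divide)
  also have "b powr (- 1 / 4) * sqrt b = b powr (1 / 4)"
    using b by (simp add: powr_half_sqrt[symmetric] flip: powr_add)
  also have "b powr (1 / 4) / sqrt b = b powr (- 1 / 4)"
    using b by (simp add: powr_half_sqrt[symmetric] flip: powr_diff)
  finally show "fourier (\<lambda>x. of_real (two_scale b x)) \<xi> = of_real (two_scale b \<xi>)"
    by (simp add: two_scale_def add.commute)
qed

definition two_scale_int :: "real \<Rightarrow> real \<Rightarrow> real" where
  "two_scale_int p b = (LINT x|lborel. two_scale b x powr p)"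

text \<open>Both rates \<open>1 / b\<close> and \<open>b\<close> are at least \<open>1 / L\<close>,
  so one Gaussian dominates the family for all \<open>b\<close> in the interval; continuity in
  \<open>b\<close> then follows by dominated convergence.\<close>

lemma two_scale_le:
  assumes "1 \<le> b" "b \<le> L"
  shows "two_scale b x \<le> (1 + L powr (1 / 4)) * exp (- pi * (1 / L) * x\<^sup>2)"
proof -
  have "b powr (- 1 / 4) \<le> 1" using assms by (simp add: powr_minus_divide ge_one_powr_ge_zero)
  moreover have "b powr (1 / 4) \<le> L powr (1 / 4)" using assms by (intro powr_mono2) auto
  moreover have "pi * (1 / L * x\<^sup>2) \<le> pi * (1 / b * x\<^sup>2)"
    using assms by (intro mult_left_mono mult_right_mono) (auto simp: frac_le)
  moreover have "pi * (1 / L * x\<^sup>2) \<le> pi * (b * x\<^sup>2)"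
    using assms by (intro mult_left_mono mult_right_mono order_trans[of "1 / L" 1 b]) auto
  ultimately show ?thesis
    unfolding two_scale_def distrib_right using assms
    by (intro add_mono mult_mono) (auto simp: mult.assoc)
qed

lemma integrable_two_scale:
  assumes b: "0 < b" and p: "1 \<le> p"
  shows "integrable lborel (\<lambda>x. two_scale b x powr p)"
  using decays_integrable_powr[OF schwartz_decays0[OF two_scale_schwartz[OF b]] p]
    two_scale_pos[OF b] by (simp add: less_imp_le)

lemma continuous_two_scale_int:
  assumes p: "1 \<le> p"
  shows "continuous_on {1..L} (two_scale_int p)"
proof (rule continuous_on_sequentiallyI)
  fix u a
  assume u: "\<forall>n. u n \<in> {1..L}" "a \<in> {1..L}" "u \<longlonglongrightarrow> a"
  then have L: "1 \<le> L" by auto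
  define K where "K = (1 + L powr (1 / 4)) powr p"
  show "(\<lambda>n. two_scale_int p (u n)) \<longlonglongrightarrow> two_scale_int p a"
    unfolding two_scale_int_def
  proof (rule integral_dominated_convergence[where w = "\<lambda>x. K * exp (- pi * (p / L) * x\<^sup>2)"])
    show "integrable lborel (\<lambda>x. K * exp (- pi * (p / L) * x\<^sup>2))"
      using p L by (intro integrable_mult_right integrable_gaussian) simp
    have "(\<lambda>n. two_scale (u n) x powr p) \<longlonglongrightarrow> two_scale a x powr p" for x
      unfolding two_scale_def using u two_scale_pos[of a x]
      by (intro tendsto_intros) (auto simp: two_scale_def)
    then show "AE x in lborel. (\<lambda>n. two_scale (u n) x powr p) \<longlonglongrightarrow> two_scale a x powr p" by simp
    have "two_scale b x powr p \<le> K * exp (- pi * (p / L) * x\<^sup>2)" if "1 \<le> b" "b \<le> L" for b x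
    proof -
      have "two_scale b x powr p \<le> ((1 + L powr (1 / 4)) * exp (- pi * (1 / L) * x\<^sup>2)) powr p"
        using that p two_scale_pos[of b x] by (intro powr_mono2 two_scale_le) auto
      also have "\<dots> = K * exp (- pi * (p / L) * x\<^sup>2)"
        by (simp add: K_def powr_mult) (simp add: powr_def)
      finally show ?thesis .
    qed
    then show "AE x in lborel. norm (two_scale (u n) x powr p) \<le> K * exp (- pi * (p / L) * x\<^sup>2)" for n
      using u by auto
  qed measurable
qed

lemma two_scale_int_pos:
  assumes "0 < b" "1 \<le> p"
  shows "0 < two_scale_int p b"
proof -
  have "two_scale_int p b \<noteq> 0"
  proof
    assume "two_scale_int p b = 0"
    then have "AE x in lborel. two_scale b x powr p = 0"
      unfolding two_scale_int_def using integrable_two_scale[OF assms]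
      by (subst (asm) integral_nonneg_eq_0_iff_AE) auto
    then have "AE x in lborel. x \<in> ({} :: real set)"
      using two_scale_pos[OF assms(1)] by (auto simp: less_imp_neq[symmetric] elim: eventually_mono)
    then show False by (simp add: AE_iff_measurable[OF _ refl])
  qed
  moreover have "0 \<le> two_scale_int p b"
    unfolding two_scale_int_def by (intro integral_nonneg_AE) auto
  ultimately show ?thesis by simp
qed

lemma Fq_two_scale:
  assumes b: "0 < b" and q: "1 \<le> q"
  shows "Fq q (\<lambda>x. of_real (two_scale b x)) = two_scale_int q b powr (2 / q) / two_scale_int 2 b"
proof -
  have L: "Lq_norm p (\<lambda>x. of_real (two_scale b x)) = two_scale_int p b powr (1 / p)" for p
    using two_scale_pos[OF b] by (simp add: Lq_norm_def two_scale_int_def less_imp_le)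
  have "two_scale_int q b powr (1 / q) * two_scale_int q b powr (1 / q) = two_scale_int q b powr (2 / q)"
    by (simp flip: powr_add)
  moreover have "two_scale_int 2 b powr (1 / 2) * two_scale_int 2 b powr (1 / 2) = two_scale_int 2 b"
    using two_scale_int_pos[OF b, of 2] by (simp flip: powr_add)
  ultimately show ?thesis by (simp only: Fq_def fourier_two_scale[OF b] L)
qed

lemma two_scale_int_1: "0 < p \<Longrightarrow> two_scale_int p 1 = 2 powr p / sqrt p"
proof -
  assume p: "0 < p"
  have "two_scale 1 x powr p = 2 powr p * exp (- pi * p * x\<^sup>2)" for x
    by (simp add: two_scale_def powr_mult flip: mult_2) (simp add: powr_def)
  then show ?thesis
    using p integral_gaussian[OF p] by (simp add: two_scale_int_def)
qed

text \<open>Only the narrow term is kept: its height to the power \<open>p\<close> is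
  \<open>b powr (p / 4)\<close> and its width is of order \<open>b powr (- 1 / 2)\<close>. For
  \<open>p > 2\<close> the product grows with \<open>b\<close>.\<close>

lemma two_scale_int_ge:
  assumes b: "0 < b" and p: "1 \<le> p"
  shows "b powr (p / 4 - 1 / 2) / sqrt p \<le> two_scale_int p b"
proof -
  have "b powr (p / 4 - 1 / 2) / sqrt p = (LINT x|lborel. b powr (p / 4) * exp (- pi * (p * b) * x\<^sup>2))"
    using b p integral_gaussian[of "p * b"]
    by (simp add: powr_diff powr_half_sqrt real_sqrt_mult)
  also have "\<dots> = (LINT x|lborel. (b powr (1 / 4) * exp (- pi * b * x\<^sup>2)) powr p)"
    using b by (simp add: powr_mult powr_powr) (simp add: powr_def ac_simps)
  also have "\<dots> \<le> two_scale_int p b"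
    unfolding two_scale_int_def
  proof (rule integral_mono_AE')
    show "AE x in lborel. (b powr (1 / 4) * exp (- pi * b * x\<^sup>2)) powr p \<le> two_scale b x powr p"
      using p by (intro always_eventually allI powr_mono2) (auto simp: two_scale_def)
  qed (use integrable_two_scale[OF b p] in auto)
  finally show ?thesis .
qed

text \<open>The square of the sum is at most twice the sum of the squares, and each square
  integrates to \<open>1 / sqrt 2\<close>. The bound is uniform in \<open>b\<close>.\<close>

lemma two_scale_int_2_le:
  assumes b: "0 < b"
  shows "two_scale_int 2 b \<le> 2 * sqrt 2"
proof -
  let ?g = "\<lambda>x. 2 * (b powr (- 1 / 2) * exp (- pi * (2 / b) * x\<^sup>2)) + 2 * (b powr (1 / 2) * exp (- pi * (2 * b) * x\<^sup>2))"
  have int: "integrable lborel (\<lambda>x. c * (d * exp (- pi * a * x\<^sup>2)))" if "0 < a" for a c d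
    by (intro integrable_mult_right integrable_gaussian that)
  have "two_scale_int 2 b \<le> (LINT x|lborel. ?g x)"
    unfolding two_scale_int_def
  proof (rule integral_mono_AE')
    show "integrable lborel ?g" using b by (intro Bochner_Integration.integrable_add int) auto
    have sq: "(b powr r * exp (- pi * a * x\<^sup>2))\<^sup>2 = b powr (2 * r) * exp (- pi * (2 * a) * x\<^sup>2)" for r a x
    proof -
      have "(b powr r)\<^sup>2 = b powr (2 * r)" by (simp add: power2_eq_square flip: powr_add)
      moreover have "(exp (- pi * a * x\<^sup>2))\<^sup>2 = exp (- pi * (2 * a) * x\<^sup>2)" by (simp flip: exp_double)
      ultimately show ?thesis by (simp only: power_mult_distrib)
    qed
    have "two_scale b x powr 2 \<le> ?g x" for x
    proof -
      have "two_scale b x powr 2 = (two_scale b x)\<^sup>2"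
        using two_scale_pos[OF b, of x] by simp
      also have "\<dots> \<le> 2 * (b powr (- 1 / 4) * exp (- pi * (1 / b) * x\<^sup>2))\<^sup>2 + 2 * (b powr (1 / 4) * exp (- pi * b * x\<^sup>2))\<^sup>2"
        unfolding two_scale_def power2_sum
        using sum_squares_bound[of "b powr (- 1 / 4) * exp (- pi * (1 / b) * x\<^sup>2)" "b powr (1 / 4) * exp (- pi * b * x\<^sup>2)"]
        by linarith
      also have "\<dots> = ?g x" unfolding sq by simp
      finally show ?thesis .
    qed
    then show "AE x in lborel. two_scale b x powr 2 \<le> ?g x" by simp
  qed simp
  also have "\<dots> = 2 * (b powr (- 1 / 2) * (1 / sqrt (2 / b))) + 2 * (b powr (1 / 2) * (1 / sqrt (2 * b)))"
    using int[of "2 / b" 2 "b powr (- 1 / 2)"] int[of "2 * b" 2 "b powr (1 / 2)"] b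
      integral_gaussian[of "2 / b"] integral_gaussian[of "2 * b"] by simp
  also have "\<dots> = 2 * sqrt 2"
    using b by (simp add: powr_minus_divide powr_half_sqrt real_sqrt_mult real_sqrt_divide field_simps)
  finally show ?thesis .
qed

lemma two_scale_Fq_image:
  assumes q: "2 < q" and v: "sqrt 2 * q powr (- 1 / q) \<le> v"
  shows "v \<in> Fq q ` (schwartz - {\<lambda>x. 0})"
proof -
  define \<phi> where "\<phi> b = two_scale_int q b powr (2 / q) / two_scale_int 2 b" for b
  \<comment> \<open>\<open>k\<close> and \<open>K\<close> arise by raising the bound of
    \<open>two_scale_int_ge\<close> to the power \<open>2 / q\<close> and dividing by
    \<open>2 * sqrt 2\<close>; \<open>q > 2\<close> makes \<open>k\<close> positive, so the quotient
    is unbounded.\<close>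
  define k where "k = 1 / 2 - 1 / q"
  define K where "K = q powr (- 1 / q) / (2 * sqrt 2)"
  have k: "0 < k" and K: "0 < K" using q by (auto simp: k_def K_def field_simps)
  have lower: "K * b powr k \<le> \<phi> b" if b: "0 < b" for b
  proof -
    have "(b powr (q / 4 - 1 / 2) / sqrt q) powr (2 / q) = b powr k * q powr (- 1 / q)"
    proof -
      have "(q / 4 - 1 / 2) * (2 / q) = k" "1 / 2 * (2 / q) = 1 / q"
        using q by (simp_all add: k_def field_simps)
      then show ?thesis
        using q by (simp only: powr_divide powr_powr powr_half_sqrt[symmetric]) (simp add: powr_minus_divide)
    qed
    then have "K * b powr k = (b powr (q / 4 - 1 / 2) / sqrt q) powr (2 / q) / (2 * sqrt 2)"
      by (simp add: K_def)
    also have "\<dots> \<le> two_scale_int q b powr (2 / q) / (2 * sqrt 2)"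
      using two_scale_int_ge[OF b, of q] q by (intro divide_right_mono powr_mono2) auto
    also have "\<dots> \<le> \<phi> b"
      unfolding \<phi>_def using two_scale_int_2_le[OF b] two_scale_int_pos[OF b, of 2]
      by (intro divide_left_mono) auto
    finally show ?thesis .
  qed
  have "filterlim (\<lambda>b. K * b powr k) at_top at_top" using k K by real_asymp
  then have "eventually (\<lambda>b. v \<le> K * b powr k \<and> 1 \<le> b) at_top"
    by (intro eventually_conj eventually_ge_at_top) (simp add: filterlim_at_top)
  then obtain L where L: "v \<le> K * L powr k" "1 \<le> L" by (auto dest: eventually_happens)
  have "continuous_on {1..L} \<phi>"
    unfolding \<phi>_def[abs_def] using q two_scale_int_pos
    by (intro continuous_intros continuous_two_scale_int) (auto simp: less_imp_neq[symmetric])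
  moreover have "\<phi> 1 \<le> v"
  proof -
    \<comment> \<open>At \<open>b = 1\<close> the two terms coincide, the common factor 2 cancels,
      and the value is that of a single Gaussian, the same threshold at which the chirps
      stop.\<close>
    have "\<phi> 1 = (2 powr q / sqrt q) powr (2 / q) / (2 powr 2 / sqrt 2)"
      using q by (simp add: \<phi>_def two_scale_int_1)
    also have "\<dots> = sqrt 2 * q powr (- 1 / q)"
      using q by (simp add: powr_divide powr_powr powr_minus_divide powr_half_sqrt[symmetric])
    finally show ?thesis using v by simp
  qed
  moreover have "v \<le> \<phi> L" using L lower[of L] by simp
  ultimately obtain b where b: "1 \<le> b" "\<phi> b = v" using IVT'[of \<phi> 1 v L] L by auto
  then have "Fq q (\<lambda>x. of_real (two_scale b x)) = v"
    using q by (simp add: Fq_two_scale \<phi>_def)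
  moreover have "(\<lambda>x. complex_of_real (two_scale b x)) \<noteq> (\<lambda>x. 0)"
    using two_scale_pos[of b 0] b by (metis less_irrefl less_le_trans of_real_eq_0_iff zero_less_one)
  moreover have "(\<lambda>x. complex_of_real (two_scale b x)) \<in> schwartz"
    using b by (intro two_scale_schwartz) simp
  ultimately show ?thesis by blast
qed

theorem theorem1p1:
  fixes q :: real
  assumes "1 < q" and "q \<noteq> 2"
  shows "(2 < q \<longrightarrow> Fq q ` (schwartz - {\<lambda>x. 0}) = {0<..}) \<and>
         (q < 2 \<longrightarrow> (\<forall>f \<in> schwartz - {\<lambda>x. 0}. 1 \<le> Fq q f))"
proof (intro conjI impI)
  assume q: "2 < q"
  have "v \<in> Fq q ` (schwartz - {\<lambda>x. 0})" if "0 < v" for v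
    using chirp_Fq_image[OF q that] two_scale_Fq_image[OF q] by (meson le_cases)
  moreover have "0 < Fq q f" if "f \<in> schwartz - {\<lambda>x. 0}" for f
    using that q by (intro Fq_pos) auto
  ultimately show "Fq q ` (schwartz - {\<lambda>x. 0}) = {0<..}" by auto
next
  assume "q < 2"
  then show "\<forall>f \<in> schwartz - {\<lambda>x. 0}. 1 \<le> Fq q f"
    using assms by (auto intro: Fq_ge_1)
qed

end
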